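(* Let $n\ge 3$ be an integer. Let $\Sigma$ be a smoothly immersed surface in $\mathbb{R}^{2n}$ which is isotropic and diffeomorphic to a compact torus. Then there exist piecewise linear immersed surfaces in $\mathbb{R}^{2n}$ which are isotropic, homeomorphic to a compact torus and arbitrarily close to $\Sigma$ with respect to the Hausdorff distance.
   Context: $\mathbb{R}^{2n}$ carries its Euclidean metric and standard symplectic form $\omega$. A smoothly immersed isotropic surface diffeomorphic to a torus means the image of a smooth immersion $\ell:T\to\mathbb{R}^{2n}$ of a surface $T$ diffeomorphic to the compact $2$-torus with $\ell^*\omega=0$. A triangulation of $\mathbb{R}^2$ is a locally finite simplicial complex, with Euclidean simplices, covering $\mathbb{R}^2$; a map $\mathbb{R}^2\to\mathbb{R}^m$ is piecewise linear if it is continuous and affine on each triangle of some triangulation. There is a conformal covering $p:\mathbb{R}^2\to T$ (for the metric induced by $\ell$) with deck transformation group a lattice of translations, and a map $T\to\mathbb{R}^m$ is piecewise linear if its lift through $p$ is piecewise linear. A piecewise linear immersed isotropic surface homeomorphic to a torus means the image of a piecewise linear map $\hat\ell:T\to\mathbb{R}^{2n}$ which is locally injective (a piecewise linear immersion) and such that the pullback of $\omega$ vanishes on each triangle of the triangulation subordinate to $\hat\ell$ (isotropic). *)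

theory Defs
  imports "HOL-Analysis.Analysis"
begin

text \<open>
  The space of dimension \<open>2n\<close> is \<open>(real^'n) \<times> (real^'n)\<close> with \<open>n = CARD('n)\<close>; its
  product inner product is the Euclidean one.
\<close>

type_synonym 'n phase_space = "(real^'n) \<times> (real^'n)"

type_synonym plane = "real \<times> real"

definition symplectic_form :: "'n::finite phase_space \<Rightarrow> 'n phase_space \<Rightarrow> real"
  where "symplectic_form u v = fst u \<bullet> snd v - snd u \<bullet> fst v"

definition isotropic_at :: "(plane \<Rightarrow> 'n::finite phase_space) \<Rightarrow> plane \<Rightarrow> bool"
  where "isotropic_at f x \<longleftrightarrow>
    (\<forall>a b. symplectic_form (frechet_derivative f (at x) a) (frechet_derivative f (at x) b) = 0)"

primrec times_cont_differentiable ::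
    "nat \<Rightarrow> ('a::euclidean_space \<Rightarrow> 'b::euclidean_space) \<Rightarrow> bool"
  where
    "times_cont_differentiable 0 f \<longleftrightarrow> continuous_on UNIV f"
  | "times_cont_differentiable (Suc k) f \<longleftrightarrow>
       (\<forall>x. f differentiable (at x)) \<and>
       (\<forall>v. times_cont_differentiable k (\<lambda>x. frechet_derivative f (at x) v))"

definition smooth_map :: "('a::euclidean_space \<Rightarrow> 'b::euclidean_space) \<Rightarrow> bool"
  where "smooth_map f \<longleftrightarrow> (\<forall>k. times_cont_differentiable k f)"

text \<open>
  The model torus. Its smooth structure is the one for which \<open>torus_param\<close> is a local
  diffeomorphism, so smoothness, derivatives and pullbacks of a map on \<open>std_torus\<close> are those
  of its composition with \<open>torus_param\<close>. Precomposing with a diffeomorphism reduces any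
  surface diffeomorphic to the torus to this one without changing the image of the immersion.
\<close>

definition std_torus :: "(complex \<times> complex) set"
  where "std_torus = sphere 0 1 \<times> sphere 0 1"

definition torus_param :: "plane \<Rightarrow> complex \<times> complex"
  where "torus_param x = (cis (2 * pi * fst x), cis (2 * pi * snd x))"

definition smooth_isotropic_immersion :: "(complex \<times> complex \<Rightarrow> 'n::finite phase_space) \<Rightarrow> bool"
  where "smooth_isotropic_immersion l \<longleftrightarrow>
    smooth_map (l \<circ> torus_param) \<and>
    (\<forall>x. inj (frechet_derivative (l \<circ> torus_param) (at x))) \<and>
    (\<forall>x. isotropic_at (l \<circ> torus_param) x)"

definition smooth_isotropic_torus :: "'n::finite phase_space set \<Rightarrow> bool"
  where "smooth_isotropic_torus S \<longleftrightarrow> (\<exists>l. smooth_isotropic_immersion l \<and> S = l ` std_torus)"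

text \<open>
  The library's \<^const>\<open>simplicial_complex\<close> is finite by definition; here finiteness is replaced
  by local finiteness.
\<close>

definition plane_triangulation :: "plane set set \<Rightarrow> bool"
  where "plane_triangulation K \<longleftrightarrow>
    (\<forall>S\<in>K. \<exists>d. d simplex S) \<and>
    (\<forall>F S. S \<in> K \<and> F face_of S \<longrightarrow> F \<in> K) \<and>
    (\<forall>S S'. S \<in> K \<and> S' \<in> K \<longrightarrow> (S \<inter> S') face_of S) \<and>
    locally_finite_in euclidean K \<and>
    \<Union>K = UNIV"

definition affine_map_on ::
    "'a::real_vector set \<Rightarrow> ('a \<Rightarrow> 'b::real_vector) \<Rightarrow> bool"
  where "affine_map_on S f \<longleftrightarrow> (\<exists>L c. linear L \<and> (\<forall>x\<in>S. f x = L x + c))"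

definition piecewise_linear_wrt ::
    "plane set set \<Rightarrow> (plane \<Rightarrow> 'b::euclidean_space) \<Rightarrow> bool"
  where "piecewise_linear_wrt K f \<longleftrightarrow>
    plane_triangulation K \<and> continuous_on UNIV f \<and>
    (\<forall>S\<in>K. 2 simplex S \<longrightarrow> affine_map_on S f)"

definition isotropic_wrt :: "plane set set \<Rightarrow> (plane \<Rightarrow> 'n::finite phase_space) \<Rightarrow> bool"
  where "isotropic_wrt K f \<longleftrightarrow>
    (\<forall>S\<in>K. 2 simplex S \<longrightarrow> (\<forall>x\<in>interior S. isotropic_at f x))"

definition plane_lattice :: "plane set \<Rightarrow> bool"
  where "plane_lattice \<Gamma> \<longleftrightarrow>
    (\<exists>u v. u \<noteq> v \<and> independent {u, v} \<and>
      \<Gamma> = {of_int i *\<^sub>R u + of_int j *\<^sub>R v | i j :: int. True})"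

definition deck_transformations ::
    "('a::topological_space \<Rightarrow> 'b) \<Rightarrow> ('a \<Rightarrow> 'a) set"
  where "deck_transformations p =
    {h. (\<exists>h'. homeomorphism UNIV UNIV h h') \<and> p \<circ> h = p}"

text \<open>
  The coverings used to define piecewise linear maps on the torus. The conformal coverings for the
  metric induced by an immersion are of this form. Conformality is not required: the main statement
  quantifies over all of these coverings.
\<close>

definition lattice_covering :: "(plane \<Rightarrow> complex \<times> complex) \<Rightarrow> bool"
  where "lattice_covering p \<longleftrightarrow>
    covering_space UNIV p std_torus \<and>
    (\<exists>\<Gamma>. plane_lattice \<Gamma> \<and> deck_transformations p = (\<lambda>\<gamma> x. x + \<gamma>) ` \<Gamma>)"

definition locally_injective_on ::
    "'a::topological_space set \<Rightarrow> ('a \<Rightarrow> 'b) \<Rightarrow> bool"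
  where "locally_injective_on T f \<longleftrightarrow>
    (\<forall>x\<in>T. \<exists>U. openin (top_of_set T) U \<and> x \<in> U \<and> inj_on f U)"

definition pl_isotropic_immersion ::
    "(plane \<Rightarrow> complex \<times> complex) \<Rightarrow> (complex \<times> complex \<Rightarrow> 'n::finite phase_space) \<Rightarrow> bool"
  where "pl_isotropic_immersion p l \<longleftrightarrow>
    locally_injective_on std_torus l \<and>
    (\<exists>K. piecewise_linear_wrt K (l \<circ> p) \<and> isotropic_wrt K (l \<circ> p))"

definition pl_isotropic_torus ::
    "(plane \<Rightarrow> complex \<times> complex) \<Rightarrow> 'n::finite phase_space set \<Rightarrow> bool"
  where "pl_isotropic_torus p S \<longleftrightarrow> (\<exists>l. pl_isotropic_immersion p l \<and> S = l ` std_torus)"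

text \<open>Meaningful for nonempty bounded sets, which is the only case used.\<close>

definition hausdorff_dist :: "'a::metric_space set \<Rightarrow> 'a set \<Rightarrow> real"
  where "hausdorff_dist S T = max (SUP x\<in>S. infdist x T) (SUP y\<in>T. infdist y S)"

end

theory Submission
  imports Defs
begin

text \<open>
  Only the Hausdorff distance of images matters, so it is enough to find a thin isotropic piecewise
  linear tube around a closed polygon lying close to, and dense up to \<open>\<mu>\<close> in, the given torus. Write
  the target as pairs \<open>(x, y)\<close>. A map \<open>(s, t) \<mapsto> (X(s, t), y(s))\<close> is isotropic iff \<open>\<partial>X/\<partial>t\<close> is
  orthogonal to \<open>y'(s)\<close>. Along the polygon, two kinds of steps alternate:

  \<^item> moves: the loop \<open>X(s, _)\<close> is translated, and lies in a plane orthogonal to the constant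
    vector \<open>y' = w \<noteq> 0\<close>;
  \<^item> pauses: \<open>y\<close> is constant, so \<open>X\<close> is arbitrary, and the loop is tilted into the plane
    required by the next move.

  All loops are graphs, in a fixed direction \<open>e1\<close>, over one triangle in the plane of \<open>e2\<close> and \<open>e3\<close>
  (this is where \<open>n \<ge> 3\<close> enters); the polygon is perturbed so that \<open>w \<bullet> e1 \<noteq> 0\<close>. During a pause
  the loop also advances in direction \<open>e1\<close> by more than the tilt, hence the tube is immersed: in a move
  \<open>s\<close> is determined by \<open>y\<close>, and in a pause \<open>t\<close> is determined by the \<open>e2\<close> and \<open>e3\<close> coordinates and
  then \<open>s\<close> by the \<open>e1\<close> coordinate.
\<close>

subsection \<open>The Freudenthal triangulation of the plane\<close>

text \<open>A slab between consecutive integer levels of the functional given by \<open>v\<close>.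
  The triangles are cut out by three families of parallel slabs, so face-to-face incidence can be
  checked one family at a time.\<close>

definition strip :: "plane \<Rightarrow> int \<Rightarrow> plane set"
  where "strip v k = {z. of_int k \<le> v \<bullet> z \<and> v \<bullet> z \<le> of_int k + 1}"

lemma convex_strip: "convex (strip v k)"
proof -
  have "strip v k = {z. v \<bullet> z \<ge> of_int k} \<inter> {z. v \<bullet> z \<le> of_int k + 1}"
    by (auto simp: strip_def)
  then show ?thesis
    by (simp add: convex_Int convex_halfspace_ge convex_halfspace_le)
qed

text \<open>Two slabs of one family coincide, are adjacent or are disjoint. In the adjacent case the
  intersection with \<open>C\<close> is cut out by a supporting hyperplane of
  \<open>C\<close>.\<close>

lemma Int_strip_face_of:
  assumes "convex C" "C \<subseteq> strip v k"
  shows "(C \<inter> strip v k') face_of C"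
proof -
  consider "k' = k" | "k' = k + 1" | "k' = k - 1" | "k' < k - 1 \<or> k' > k + 1"
    by linarith
  then show ?thesis
  proof cases
    case 1
    then have "C \<inter> strip v k' = C" using assms by auto
    then show ?thesis using assms by (simp add: face_of_refl)
  next
    case 2
    then have "C \<inter> strip v k' = C \<inter> {z. v \<bullet> z = of_int k + 1}"
      using assms by (auto simp: strip_def)
    then show ?thesis
      using face_of_Int_supporting_hyperplane_le[OF \<open>convex C\<close>, of v "of_int k + 1"] assms(2)
      by (auto simp: strip_def)
  next
    case 3
    then have "C \<inter> strip v k' = C \<inter> {z. v \<bullet> z = of_int k}"
      using assms by (auto simp: strip_def)
    then show ?thesis
      using face_of_Int_supporting_hyperplane_ge[OF \<open>convex C\<close>, of "of_int k" v] assms(2)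
      by (auto simp: strip_def)
  next
    case 4
    have "z \<notin> strip v k'" if "z \<in> C" for z
    proof -
      have "of_int k \<le> v \<bullet> z" "v \<bullet> z \<le> of_int k + 1"
        using that assms(2) by (auto simp: strip_def)
      moreover have "real_of_int k' + 1 < of_int k \<or> of_int k' > real_of_int k + 1"
        using 4 by linarith
      ultimately show ?thesis by (auto simp: strip_def)
    qed
    then have "C \<inter> strip v k' = {}" by blast
    then show ?thesis by simp
  qed
qed

text \<open>A triangle for \<open>d = i - j\<close> (below the diagonal of the unit square) and \<open>d = i - j - 1\<close> (above it).\<close>

definition cell :: "int \<Rightarrow> int \<Rightarrow> int \<Rightarrow> plane set"
  where "cell i j d = strip (1, 0) i \<inter> strip (0, 1) j \<inter> strip (1, -1) d"

lemma mem_cell: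
  "(s, t) \<in> cell i j d \<longleftrightarrow>
    of_int i \<le> s \<and> s \<le> of_int i + 1 \<and> of_int j \<le> t \<and> t \<le> of_int j + 1 \<and>
    of_int d \<le> s - t \<and> s - t \<le> of_int d + 1"
  by (auto simp: cell_def strip_def)

lemma convex_cell: "convex (cell i j d)"
  by (simp add: cell_def convex_Int convex_strip)

lemma cell_Int_face_of: "(cell i j d \<inter> cell i' j' d') face_of cell i j d"
proof -
  have "cell i j d \<inter> cell i' j' d' = (cell i j d \<inter> strip (1, 0) i') \<inter>
      (cell i j d \<inter> strip (0, 1) j') \<inter> (cell i j d \<inter> strip (1, -1) d')"
    by (auto simp: cell_def)
  moreover have "(cell i j d \<inter> strip (1, 0) i') face_of cell i j d"
    by (rule Int_strip_face_of[OF convex_cell, of _ _ _ _ i]) (auto simp: cell_def)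
  moreover have "(cell i j d \<inter> strip (0, 1) j') face_of cell i j d"
    by (rule Int_strip_face_of[OF convex_cell, of _ _ _ _ j]) (auto simp: cell_def)
  moreover have "(cell i j d \<inter> strip (1, -1) d') face_of cell i j d"
    by (rule Int_strip_face_of[OF convex_cell, of _ _ _ _ d]) (auto simp: cell_def)
  ultimately show ?thesis by (simp add: face_of_Int)
qed

lemma lower_cell_eq_convex_hull:
  "cell i j (i - j) = convex hull
    {(of_int i, of_int j), (of_int i + 1, of_int j), (of_int i + 1, of_int j + 1)}"
proof (rule set_eqI, clarify)
  fix s t :: real
  show "(s, t) \<in> cell i j (i - j) \<longleftrightarrow> (s, t) \<in> convex hull
      {(of_int i, of_int j), (of_int i + 1, of_int j), (of_int i + 1, of_int j + 1)}"
    unfolding mem_cell convex_hull_3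
  proof (safe, goal_cases)
    case 1
    show ?case
      \<comment> \<open>Barycentric coordinates: only the last vertex raises the second coordinate,
        which gives \<open>t - j\<close>, and the last two vertices together raise the first one by
        \<open>s - i\<close>.\<close>
      by (rule exI[of _ "1 - (s - i)"], rule exI[of _ "(s - i) - (t - j)"], rule exI[of _ "t - j"])
        (use 1 in \<open>auto simp: algebra_simps\<close>)
  qed (auto simp: algebra_simps dest!: eq_diff_eq[THEN iffD2] intro: mult_left_mono)
qed

lemma upper_cell_eq_convex_hull:
  "cell i j (i - j - 1) = convex hull
    {(of_int i, of_int j), (of_int i, of_int j + 1), (of_int i + 1, of_int j + 1)}"
proof (rule set_eqI, clarify)
  fix s t :: real
  show "(s, t) \<in> cell i j (i - j - 1) \<longleftrightarrow> (s, t) \<in> convex hull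
      {(of_int i, of_int j), (of_int i, of_int j + 1), (of_int i + 1, of_int j + 1)}"
    unfolding mem_cell convex_hull_3
  proof (safe, goal_cases)
    case 1
    show ?case
      by (rule exI[of _ "1 - (t - j)"], rule exI[of _ "(t - j) - (s - i)"], rule exI[of _ "s - i"])
        (use 1 in \<open>auto simp: algebra_simps\<close>)
  qed (auto simp: algebra_simps dest!: eq_diff_eq[THEN iffD2] intro: mult_left_mono)
qed

text \<open>A nonzero determinant of the edge vectors at \<open>a\<close> excludes collinearity,
  which for three points amounts to affine independence.\<close>

lemma simplex_triangle:
  fixes a b c :: plane
  assumes "fst (b - a) * snd (c - a) \<noteq> snd (b - a) * fst (c - a)"
  shows "2 simplex (convex hull {a, b, c})"
proof -
  have "\<not> collinear {a, b, c}"
  proof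
    assume "collinear {a, b, c}"
    then have "collinear {b, a, c}" by (simp add: insert_commute)
    then have "collinear {0, b - a, c - a}" by (simp add: collinear_3)
    then have "b - a = 0 \<or> c - a = 0 \<or> (\<exists>k. c - a = k *\<^sub>R (b - a))"
      by (simp only: collinear_lemma)
    then show False using assms
    proof (elim disjE exE)
      fix k assume "c - a = k *\<^sub>R (b - a)"
      then show False using assms by (simp only: fst_scaleR snd_scaleR) simp
    qed simp_all
  qed
  then have "\<not> affine_dependent {a, b, c}" "card {a, b, c} = 3"
    using affine_dependent_imp_collinear_3
    by (blast, metis (no_types, lifting) card_3_iff collinear_2 insert_absorb2 insert_commute)
  then show ?thesis unfolding simplex_def by (intro exI[of _ "{a, b, c}"]) simp
qed

lemma simplex_cell:
  assumes "d \<in> {i - j - 1, i - j}"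
  shows "2 simplex (cell i j d)"
  using assms by (auto simp: lower_cell_eq_convex_hull upper_cell_eq_convex_hull intro!: simplex_triangle)

lemma simplex_face:
  assumes "d simplex S" "F face_of S"
  shows "\<exists>e. e simplex F"
proof -
  obtain C where C: "\<not> affine_dependent C" "int (card C) = d + 1" "S = convex hull C"
    using assms(1) by (auto simp: simplex_def)
  have "compact C" using C(1) aff_independent_finite finite_imp_compact by blast
  then obtain C' where "C' \<subseteq> C" "F = convex hull C'"
    using assms(2) C(3) face_of_convex_hull_subset by metis
  then have "(int (card C') - 1) simplex F"
    using C(1) affine_independent_subset unfolding simplex_def by (intro exI[of _ C']) auto
  then show ?thesis ..
qed

text \<open>For other values of \<open>d\<close> the three slabs meet in at most one point.
  Including all faces makes closure under faces a matter of transitivity.\<close>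

definition freudenthal :: "plane set set"
  where "freudenthal = {F. \<exists>i j d. d \<in> {i - j - 1, i - j} \<and> F face_of cell i j d}"

text \<open>Passes from cells to their faces: \<open>S'\<close> cuts the common face
  \<open>T \<inter> T'\<close> in a face, which by transitivity is a face of \<open>T\<close>, and
  intersecting it with \<open>S\<close> leaves \<open>S \<inter> S'\<close>.\<close>

lemma Int_of_faces_face_of:
  assumes "S face_of T" "S' face_of T'" "(T \<inter> T') face_of T" "(T \<inter> T') face_of T'"
  shows "(S \<inter> S') face_of S"
proof -
  have "(S' \<inter> (T \<inter> T')) face_of T'" by (rule face_of_Int[OF assms(2,4)])
  then have "(S' \<inter> (T \<inter> T')) face_of (T \<inter> T')" by (rule face_of_subset) auto
  then have "(S' \<inter> (T \<inter> T')) face_of T" using assms(3) face_of_trans by blast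
  then have "(S \<inter> (S' \<inter> (T \<inter> T'))) face_of T" using assms(1) face_of_Int by blast
  moreover have "S \<inter> (S' \<inter> (T \<inter> T')) = S \<inter> S'"
    using assms(1,2) face_of_imp_subset by blast
  ultimately show ?thesis using face_of_imp_subset[OF assms(1)] face_of_subset by fastforce
qed

lemma mem_cell_floor:
  "\<exists>d \<in> {\<lfloor>s\<rfloor> - \<lfloor>t\<rfloor> - 1, \<lfloor>s\<rfloor> - \<lfloor>t\<rfloor>}. (s, t) \<in> cell \<lfloor>s\<rfloor> \<lfloor>t\<rfloor> d"
proof (cases "s - \<lfloor>s\<rfloor> \<ge> t - \<lfloor>t\<rfloor>")
  case True
  then have "(s, t) \<in> cell \<lfloor>s\<rfloor> \<lfloor>t\<rfloor> (\<lfloor>s\<rfloor> - \<lfloor>t\<rfloor>)"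
    unfolding mem_cell of_int_diff by linarith
  then show ?thesis by blast
next
  case False
  then have "(s, t) \<in> cell \<lfloor>s\<rfloor> \<lfloor>t\<rfloor> (\<lfloor>s\<rfloor> - \<lfloor>t\<rfloor> - 1)"
    unfolding mem_cell of_int_diff by simp linarith
  then show ?thesis by blast
qed

lemma finite_faces_of_cell:
  assumes "d \<in> {i - j - 1, i - j}"
  shows "finite {F. F face_of cell i j d}"
proof -
  have "polytope (cell i j d)" using simplex_cell[OF assms] simplex_imp_polytope by blast
  then show ?thesis by (simp add: finite_polytope_faces)
qed

lemma locally_finite_freudenthal: "locally_finite_in euclidean freudenthal"
  unfolding locally_finite_in_def
proof (intro conjI ballI)
  fix z :: plane
  obtain s t where z: "z = (s, t)" by fastforce
  \<comment> \<open>Cells have unit width, so one that meets this window has its corner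
    \<open>(i, j)\<close> within 2 of the floors in each coordinate. This leaves finitely many
    cells, each with finitely many faces.\<close>
  define V where "V = {\<lfloor>s\<rfloor> - 1 <..< real_of_int \<lfloor>s\<rfloor> + 2} \<times> {\<lfloor>t\<rfloor> - 1 <..< real_of_int \<lfloor>t\<rfloor> + 2}"
  have "open V" by (simp add: V_def open_Times)
  moreover have "z \<in> V" unfolding V_def z mem_Times_iff fst_conv snd_conv greaterThanLessThan_iff
    by (intro conjI; linarith)
  moreover have "finite {U \<in> freudenthal. U \<inter> V \<noteq> {}}"
  proof (rule finite_subset)
    define J where "J = {(i, j, d). i \<in> {\<lfloor>s\<rfloor> - 2..\<lfloor>s\<rfloor> + 2} \<and> j \<in> {\<lfloor>t\<rfloor> - 2..\<lfloor>t\<rfloor> + 2}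
      \<and> d \<in> {i - j - 1, i - j}}"
    have "J \<subseteq> {\<lfloor>s\<rfloor> - 2..\<lfloor>s\<rfloor> + 2} \<times> {\<lfloor>t\<rfloor> - 2..\<lfloor>t\<rfloor> + 2} \<times>
        {\<lfloor>s\<rfloor> - \<lfloor>t\<rfloor> - 5..\<lfloor>s\<rfloor> - \<lfloor>t\<rfloor> + 5}"
      by (auto simp: J_def)
    then have "finite J" by (rule finite_subset) auto
    then show "finite (\<Union>(i, j, d)\<in>J. {F. F face_of cell i j d})"
      using finite_faces_of_cell by (auto simp: J_def)
    show "{U \<in> freudenthal. U \<inter> V \<noteq> {}} \<subseteq> (\<Union>(i, j, d)\<in>J. {F. F face_of cell i j d})"
    proof
      fix F assume "F \<in> {U \<in> freudenthal. U \<inter> V \<noteq> {}}"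
      then obtain q where F: "F \<in> freudenthal" and q: "q \<in> F" "q \<in> V" by blast
      obtain x y where "q = (x, y)" by fastforce
      with q have xy: "(x, y) \<in> F" "(x, y) \<in> V" by simp_all
      obtain i j d where ij: "d \<in> {i - j - 1, i - j}" "F face_of cell i j d"
        using F by (auto simp: freudenthal_def)
      then have "(x, y) \<in> cell i j d" using xy face_of_imp_subset by blast
      then have "real_of_int i \<le> x" "x \<le> i + 1" "real_of_int j \<le> y" "y \<le> j + 1"
        unfolding mem_cell by auto
      moreover have "\<lfloor>s\<rfloor> - 1 < x" "x < \<lfloor>s\<rfloor> + 2" "\<lfloor>t\<rfloor> - 1 < y" "y < \<lfloor>t\<rfloor> + 2"
        using xy(2) by (auto simp: V_def)
      ultimately have "\<lfloor>s\<rfloor> - 2 \<le> i" "i \<le> \<lfloor>s\<rfloor> + 2" "\<lfloor>t\<rfloor> - 2 \<le> j" "j \<le> \<lfloor>t\<rfloor> + 2"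
        by linarith+
      then have "(i, j, d) \<in> J" using ij(1) unfolding J_def by simp
      then show "F \<in> (\<Union>(i, j, d)\<in>J. {F. F face_of cell i j d})" using ij(2) by blast
    qed
  qed
  ultimately show "\<exists>V. openin euclidean V \<and> z \<in> V \<and> finite {U \<in> freudenthal. U \<inter> V \<noteq> {}}"
    by (auto simp: open_openin[symmetric])
qed auto

lemma plane_triangulation_freudenthal: "plane_triangulation freudenthal"
  unfolding plane_triangulation_def
proof (intro conjI ballI allI impI)
  fix S assume "S \<in> freudenthal"
  then show "\<exists>d. d simplex S" using simplex_cell simplex_face unfolding freudenthal_def by blast
next
  fix F S assume "S \<in> freudenthal \<and> F face_of S"
  then show "F \<in> freudenthal" unfolding freudenthal_def using face_of_trans by blast
next
  fix S S' assume "S \<in> freudenthal \<and> S' \<in> freudenthal"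
  then obtain i j d i' j' d' where "S face_of cell i j d" "S' face_of cell i' j' d'"
    unfolding freudenthal_def by blast
  then show "S \<inter> S' face_of S"
    using cell_Int_face_of[of i j d i' j' d'] cell_Int_face_of[of i' j' d' i j d]
    by (intro Int_of_faces_face_of[of S "cell i j d" S' "cell i' j' d'"]) (simp_all add: Int_commute)
next
  show "\<Union> freudenthal = UNIV"
  proof -
    have "cell i j d \<in> freudenthal" if "d \<in> {i - j - 1, i - j}" for i j d
      unfolding freudenthal_def using that convex_cell face_of_refl by blast
    then have "(s, t) \<in> \<Union> freudenthal" for s t using mem_cell_floor[of s t] by blast
    then show ?thesis by auto
  qed
qed (rule locally_finite_freudenthal)

section \<open>Linear images of triangulations\<close>

lemma simplex_linear_image:
  fixes f :: "'a::euclidean_space \<Rightarrow> 'b::euclidean_space"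
  assumes "linear f" "inj f" "d simplex S"
  shows "d simplex (f ` S)"
proof -
  obtain C where C: "\<not> affine_dependent C" "int (card C) = d + 1" "S = convex hull C"
    using assms(3) by (auto simp: simplex_def)
  have "\<not> affine_dependent (f ` C)"
  proof
    assume "affine_dependent (f ` C)"
    then obtain x where x: "x \<in> C" "f x \<in> affine hull (f ` C - {f x})"
      by (auto simp: affine_dependent_def)
    have "f ` C - {f x} = f ` (C - {x})" using assms(2) by (auto simp: inj_eq)
    then have "f x \<in> f ` (affine hull (C - {x}))"
      using x(2) affine_hull_linear_image[of f "C - {x}"] assms(1)
      by (simp add: linear_conv_bounded_linear)
    then have "x \<in> affine hull (C - {x})" using assms(2) by (auto simp: inj_eq)
    then show False using C(1) x(1) by (auto simp: affine_dependent_def)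
  qed
  moreover have "card (f ` C) = card C" using assms(2) by (meson card_image inj_on_subset subset_UNIV)
  moreover have "f ` S = convex hull (f ` C)"
    using convex_hull_linear_image[OF assms(1)] C(3) by simp
  ultimately show ?thesis unfolding simplex_def using C(2) by (intro exI[of _ "f ` C"]) simp
qed

lemma finite_image_meets:
  assumes "inj f" "finite {U \<in> K. U \<inter> V \<noteq> {}}"
  shows "finite {U \<in> (`) f ` K. U \<inter> inv f -` V \<noteq> {}}"
proof (rule finite_surj[OF assms(2), of _ "(`) f"], rule subsetI)
  fix T assume "T \<in> {U \<in> (`) f ` K. U \<inter> inv f -` V \<noteq> {}}"
  then obtain S where S: "S \<in> K" "T = f ` S" "f ` S \<inter> inv f -` V \<noteq> {}" by blast
  then obtain z where "z \<in> S" "inv f (f z) \<in> V" by blast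
  then have "z \<in> S \<inter> V" using assms(1) by simp
  then have "S \<in> {U \<in> K. U \<inter> V \<noteq> {}}" using S(1) by blast
  then show "T \<in> (`) f ` {U \<in> K. U \<inter> V \<noteq> {}}" unfolding S(2) by (rule imageI)
qed

text \<open>An injective linear map preserves simplices and faces, and local finiteness is pulled
  back along the continuous inverse. This adapts the integer triangulation to an arbitrary
  lattice.\<close>

lemma plane_triangulation_linear_image:
  assumes "plane_triangulation K" "linear f" "bij f"
  shows "plane_triangulation ((`) f ` K)"
proof -
  have inj: "inj f" and surj: "surj f" using assms(3) by (auto simp: bij_def)
  show ?thesis
    unfolding plane_triangulation_def
  proof (intro conjI ballI allI impI)
    fix S assume "S \<in> (`) f ` K"
    then show "\<exists>d. d simplex S"
      using assms(1) simplex_linear_image[OF assms(2) inj] unfolding plane_triangulation_def by blast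
  next
    fix F S assume "S \<in> (`) f ` K \<and> F face_of S"
    then obtain S0 where S0: "S0 \<in> K" "F face_of (f ` S0)" by blast
    have "F = f ` (f -` F)" using surj by (simp add: surj_image_vimage_eq)
    moreover have "(f -` F) face_of S0"
      using S0(2) calculation face_of_linear_image[OF assms(2) inj] by metis
    then have "f -` F \<in> K" using assms(1) S0(1) unfolding plane_triangulation_def by blast
    ultimately show "F \<in> (`) f ` K" by blast
  next
    fix S S' assume "S \<in> (`) f ` K \<and> S' \<in> (`) f ` K"
    then show "S \<inter> S' face_of S"
      using assms(1) face_of_linear_image[OF assms(2) inj] 
      unfolding plane_triangulation_def by (auto simp: image_Int[OF inj, symmetric])
  next
    have "continuous_on UNIV (inv f)"
      using assms(2) inj by (simp add: linear_continuous_on linear_conv_bounded_linear[symmetric]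
          inj_linear_imp_inv_linear)
    show "locally_finite_in euclidean ((`) f ` K)"
      unfolding locally_finite_in_def
    proof (intro conjI ballI)
      fix x
      obtain V where V: "open V" "inv f x \<in> V" "finite {U \<in> K. U \<inter> V \<noteq> {}}"
      proof -
        have "locally_finite_in euclidean K" using assms(1) by (simp add: plane_triangulation_def)
        then have "\<forall>x. \<exists>V. open V \<and> x \<in> V \<and> finite {U \<in> K. U \<inter> V \<noteq> {}}"
          by (simp add: locally_finite_in_def)
        then show thesis using that by blast
      qed
      have "open (inv f -` V)" using \<open>continuous_on UNIV (inv f)\<close> V(1) by (simp add: open_vimage)
      moreover have "x \<in> inv f -` V" using V(2) by simp
      moreover have "finite {U \<in> (`) f ` K. U \<inter> inv f -` V \<noteq> {}}"
        by (rule finite_image_meets[OF inj V(3)])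
      ultimately show "\<exists>V. openin euclidean V \<and> x \<in> V \<and> finite {U \<in> (`) f ` K. U \<inter> V \<noteq> {}}"
        by (intro exI[of _ "inv f -` V"] conjI) simp_all
    qed auto
  next
    show "\<Union> ((`) f ` K) = UNIV"
      using assms(1) surj unfolding plane_triangulation_def by (metis image_Union)
  qed
qed

subsection \<open>Piecewise linear interpolation and lattice coverings\<close>

text \<open>
  The interpolant of the corner values on the two triangles, written without case distinction: the
  coefficients of the two horizontal differences are nondecreasing in \<open>a\<close> and add up to \<open>a\<close>.
\<close>

definition patch :: "(int \<Rightarrow> int \<Rightarrow> 'b::real_vector) \<Rightarrow> int \<Rightarrow> int \<Rightarrow> real \<Rightarrow> real \<Rightarrow> 'b"
  where "patch V i j a b = V i j + b *\<^sub>R (V i (j + 1) - V i j) +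
    max (a - b) 0 *\<^sub>R (V (i + 1) j - V i j) + min a b *\<^sub>R (V (i + 1) (j + 1) - V i (j + 1))"

definition interp :: "(int \<Rightarrow> int \<Rightarrow> 'b::real_vector) \<Rightarrow> plane \<Rightarrow> 'b"
  where "interp V z = patch V \<lfloor>fst z\<rfloor> \<lfloor>snd z\<rfloor> (frac (fst z)) (frac (snd z))"

lemma patch_right: "0 \<le> b \<Longrightarrow> b \<le> 1 \<Longrightarrow> patch V i j 1 b = patch V (i + 1) j 0 b"
  by (simp add: patch_def max_def min_def algebra_simps)

lemma patch_top: "0 \<le> a \<Longrightarrow> a \<le> 1 \<Longrightarrow> patch V i j a 1 = patch V i (j + 1) a 0"
  by (simp add: patch_def max_def min_def algebra_simps)

text \<open>The floor jumps on the right and top edges of the closed square. There the patch of the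
  neighbouring square takes over, and the two patches agree on the common edge.\<close>

lemma interp_eq_patch:
  assumes "of_int i \<le> s" "s \<le> of_int i + 1" "of_int j \<le> t" "t \<le> of_int j + 1"
  shows "interp V (s, t) = patch V i j (s - of_int i) (t - of_int j)"
proof -
  have "interp V (s, t) = patch V i \<lfloor>t\<rfloor> (s - of_int i) (frac t)"
  proof (cases "s = of_int i + 1")
    case True
    then have "\<lfloor>s\<rfloor> = i + 1" "frac s = 0" by (auto simp: frac_def)
    then show ?thesis using True patch_right[of "frac t" V i "\<lfloor>t\<rfloor>"] frac_lt_1[of t]
      by (simp add: interp_def less_imp_le)
  next
    case False
    then have "\<lfloor>s\<rfloor> = i" using assms by (intro floor_unique) auto
    then show ?thesis by (simp add: interp_def frac_def)
  qed
  also have "\<dots> = patch V i j (s - of_int i) (t - of_int j)"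
  proof (cases "t = of_int j + 1")
    case True
    then have "\<lfloor>t\<rfloor> = j + 1" "frac t = 0" by (auto simp: frac_def)
    then show ?thesis using True patch_top[of "s - of_int i" V i j] assms by simp
  next
    case False
    then have "\<lfloor>t\<rfloor> = j" using assms by (intro floor_unique) auto
    then show ?thesis by (simp add: frac_def)
  qed
  finally show ?thesis .
qed

lemma interp_int: "interp V (of_int i, of_int j) = V i j"
  by (simp add: interp_def patch_def)

text \<open>The second conclusion identifies the partial derivatives with differences of corner
  values along the two legs of the triangle, so isotropy becomes a condition on the
  vertices.\<close>

lemma interp_cell:
  assumes "d \<in> {i - j - 1, i - j}"
  obtains P Q c
  where "\<And>z. z \<in> cell i j d \<Longrightarrow> interp V z = fst z *\<^sub>R P + snd z *\<^sub>R Q + c"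
    and "P = V (i + 1) j - V i j \<and> Q = V (i + 1) (j + 1) - V (i + 1) j \<or>
         P = V (i + 1) (j + 1) - V i (j + 1) \<and> Q = V i (j + 1) - V i j"
proof (cases "d = i - j")
  case True
  define P where "P = V (i + 1) j - V i j"
  define Q where "Q = V (i + 1) (j + 1) - V (i + 1) j"
  have "interp V z = fst z *\<^sub>R P + snd z *\<^sub>R Q + (V i j - of_int i *\<^sub>R P - of_int j *\<^sub>R Q)"
    if "z \<in> cell i j d" for z
  proof -
    obtain s t where z: "z = (s, t)" by fastforce
    have "of_int i \<le> s" "s \<le> of_int i + 1" "of_int j \<le> t" "t \<le> of_int j + 1"
      "t - of_int j \<le> s - of_int i"
      using that True by (auto simp: z mem_cell)
    then have "interp V (s, t) = patch V i j (s - of_int i) (t - of_int j)"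
      "max ((s - of_int i) - (t - of_int j)) 0 = (s - of_int i) - (t - of_int j)"
      "min (s - of_int i) (t - of_int j) = t - of_int j"
      by (auto intro: interp_eq_patch)
    then show ?thesis
      by (simp add: z patch_def P_def Q_def scaleR_right_diff_distrib scaleR_left_diff_distrib)
  qed
  then show ?thesis using that P_def Q_def by blast
next
  case False
  define P where "P = V (i + 1) (j + 1) - V i (j + 1)"
  define Q where "Q = V i (j + 1) - V i j"
  have "interp V z = fst z *\<^sub>R P + snd z *\<^sub>R Q + (V i j - of_int i *\<^sub>R P - of_int j *\<^sub>R Q)"
    if "z \<in> cell i j d" for z
  proof -
    obtain s t where z: "z = (s, t)" by fastforce
    have "of_int i \<le> s" "s \<le> of_int i + 1" "of_int j \<le> t" "t \<le> of_int j + 1"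
      "t - of_int j \<ge> s - of_int i"
      using that False assms by (auto simp: z mem_cell)
    then have "interp V (s, t) = patch V i j (s - of_int i) (t - of_int j)"
      "max ((s - of_int i) - (t - of_int j)) 0 = 0"
      "min (s - of_int i) (t - of_int j) = s - of_int i"
      by (auto intro: interp_eq_patch)
    then show ?thesis
      by (simp add: z patch_def P_def Q_def scaleR_right_diff_distrib scaleR_left_diff_distrib)
  qed
  then show ?thesis using that P_def Q_def by blast
qed

section \<open>Continuity and isotropy of piecewise affine maps\<close>

lemma continuous_on_affine_map:
  fixes f :: "'a::euclidean_space \<Rightarrow> 'b::real_normed_vector"
  assumes "affine_map_on S f"
  shows "continuous_on S f"
proof -
  obtain L c where L: "linear L" "\<forall>x\<in>S. f x = L x + c"
    using assms by (auto simp: affine_map_on_def)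
  have "continuous_on S (\<lambda>x. L x + c)"
    using L(1) by (intro continuous_intros linear_continuous_on) (simp add: linear_conv_bounded_linear)
  then show ?thesis using L(2) by (simp cong: continuous_on_cong)
qed

text \<open>Simplices are closed and form a locally finite cover, so continuity on each of them
  pastes together.\<close>

lemma piecewise_affine_imp_continuous:
  fixes f :: "plane \<Rightarrow> 'b::real_normed_vector"
  assumes K: "plane_triangulation K" and f: "\<And>S. S \<in> K \<Longrightarrow> affine_map_on S f"
  shows "continuous_on UNIV f"
proof -
  have lf: "locally_finite_in euclidean K" and cover: "\<Union>K = UNIV"
    and simp: "\<forall>S\<in>K. \<exists>d. d simplex S"
    using K by (simp_all add: plane_triangulation_def)
  have "continuous_map euclidean euclidean f"
  proof (rule pasting_lemma_locally_finite[where I = K and T = "\<lambda>S. S" and f = "\<lambda>_. f"])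
    show "\<exists>V. openin euclidean V \<and> x \<in> V \<and> finite {S \<in> K. S \<inter> V \<noteq> {}}"
      if "x \<in> topspace euclidean" for x :: plane
      using lf that unfolding locally_finite_in_def by blast
    show "closedin euclidean S" if "S \<in> K" for S
      using simp that simplex_imp_polytope polytope_imp_closed closed_closedin by blast
    show "continuous_map (subtopology euclidean S) euclidean f" if "S \<in> K" for S
      using f[OF that] continuous_on_affine_map by simp
    show "\<exists>S. S \<in> K \<and> x \<in> S \<and> f x = f x" for x
      using cover by blast
  qed (rule refl)
  then show ?thesis by simp
qed

text \<open>Bilinearity and antisymmetry: a linear map of the plane pulls the form back to a
  multiple of the determinant, so isotropy on a triangle is one scalar equation.\<close>

lemma symplectic_form_linear_combination:
  "symplectic_form (a *\<^sub>R P + b *\<^sub>R Q) (c *\<^sub>R P + d *\<^sub>R Q) = (a * d - b * c) * symplectic_form P Q"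
  by (simp add: symplectic_form_def inner_add_left inner_add_right inner_commute algebra_simps)

lemma isotropic_at_affine:
  fixes f :: "plane \<Rightarrow> 'n::finite phase_space"
  assumes "x \<in> interior S" "linear L" "\<And>z. z \<in> S \<Longrightarrow> f z = L z + c"
    and "\<And>a b. symplectic_form (L a) (L b) = 0"
  shows "isotropic_at f x"
proof -
  have "((\<lambda>z. L z + c) has_derivative L) (at x)"
    using assms(2) by (auto intro!: derivative_eq_intros linear_imp_has_derivative)
  then have "(f has_derivative L) (at x)"
  proof (rule has_derivative_transform_within_open)
    show "L z + c = f z" if "z \<in> interior S" for z
      using assms(3) interior_subset that by (metis subsetD)
  qed (use assms(1) in simp_all)
  then have "frechet_derivative f (at x) = L"
    using frechet_derivative_at by metis
  then show ?thesis using assms(4) by (simp add: isotropic_at_def)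
qed

section \<open>Fibres of lattice coverings and descent to the torus\<close>

text \<open>The plane is simply connected, so \<open>p\<close> lifts through itself both to a map
  sending \<open>x\<close> to \<open>y\<close> and to one sending \<open>y\<close> to
  \<open>x\<close>. Both composites are lifts of \<open>p\<close> with a fixed point, hence the
  identity, so the first lift is a deck transformation, that is, a translation by an element of
  \<open>\<Gamma>\<close>.\<close>

lemma lattice_covering_fibre:
  assumes "lattice_covering p"
    and "deck_transformations p = (\<lambda>\<gamma> x. x + \<gamma>) ` \<Gamma>"
    and "p x = p y"
  shows "y - x \<in> \<Gamma>"
proof -
  have cov: "covering_space UNIV p std_torus"
    using assms(1) by (simp add: lattice_covering_def)
  have cont: "continuous_on UNIV p" and im: "p \<in> UNIV \<rightarrow> std_torus"
    using covering_space_imp_continuous[OF cov] covering_space_imp_surjective[OF cov] by auto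
  have sc: "simply_connected (UNIV :: plane set)"
    by (intro convex_imp_simply_connected) simp
  have lpc: "locally path_connected (UNIV :: plane set)"
    by (intro convex_imp_locally_path_connected) simp
  have lift: "\<exists>h. continuous_on UNIV h \<and> h a = b \<and> (\<forall>z. p (h z) = p z)" if "p a = p b" for a b
  proof (rule covering_space_lift_strong[OF cov _ _ sc lpc cont im that])
    fix h :: "plane \<Rightarrow> plane"
    assume "continuous_on UNIV h" "h a = b" "\<And>z. z \<in> UNIV \<Longrightarrow> p (h z) = p z"
    then show ?thesis by (intro exI[of _ h]) simp
  qed simp_all
  from lift[OF assms(3)] obtain h
    where h: "continuous_on UNIV h" "h x = y" "\<And>z. p (h z) = p z"
    by blast
  from lift[OF assms(3)[symmetric]] obtain h'
    where h': "continuous_on UNIV h'" "h' y = x" "\<And>z. p (h' z) = p z"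
    by blast
  have unique: "g z = z" if g: "continuous_on UNIV g" "\<And>z. p (g z) = p z" "g a = a" for g :: "plane \<Rightarrow> plane" and a z
  proof (rule covering_space_lift_unique[OF cov _ cont im, of g a "\<lambda>z. z" z])
    show "p z = p (g z)" for z by (simp only: g(2))
  qed (rule g UNIV_I continuous_on_id connected_UNIV refl Pi_I)+
  have "h' (h z) = z" for z
  proof (rule unique[of "\<lambda>z. h' (h z)" x])
    show "continuous_on UNIV (\<lambda>z. h' (h z))"
      by (rule continuous_on_compose2[OF h'(1) h(1) subset_UNIV])
  qed (simp_all only: h h')
  moreover have "h (h' z) = z" for z
  proof (rule unique[of "\<lambda>z. h (h' z)" y])
    show "continuous_on UNIV (\<lambda>z. h (h' z))"
      by (rule continuous_on_compose2[OF h(1) h'(1) subset_UNIV])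
  qed (simp_all only: h h')
  ultimately have "homeomorphism UNIV UNIV h h'"
    using h(1) h'(1) by (intro homeomorphismI) (rule subset_UNIV | assumption)+
  then have "h \<in> deck_transformations p"
    using h(3) unfolding deck_transformations_def comp_def by blast
  then obtain \<gamma> where "\<gamma> \<in> \<Gamma>" "h = (\<lambda>x. x + \<gamma>)" using assms(2) by auto
  then have "y - x = \<gamma>" using h(2) by (simp add: algebra_simps)
  then show ?thesis using \<open>\<gamma> \<in> \<Gamma>\<close> by simp
qed

lemma plane_basis_isomorphism:
  fixes u v :: plane
  assumes "u \<noteq> v" "independent {u, v}" "\<alpha> \<noteq> 0" "\<beta> \<noteq> 0"
  shows "linear (\<lambda>z. (fst z * \<alpha>) *\<^sub>R u + (snd z * \<beta>) *\<^sub>R v)"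
    and "bij (\<lambda>z. (fst z * \<alpha>) *\<^sub>R u + (snd z * \<beta>) *\<^sub>R v)"
proof -
  show lin: "linear (\<lambda>z. (fst z * \<alpha>) *\<^sub>R u + (snd z * \<beta>) *\<^sub>R v)"
    by (intro linearI) (auto simp: algebra_simps)
  have "inj (\<lambda>z. (fst z * \<alpha>) *\<^sub>R u + (snd z * \<beta>) *\<^sub>R v)"
    unfolding linear_injective_0[OF lin]
  proof clarify
    fix a b :: real assume eq: "(fst (a, b) * \<alpha>) *\<^sub>R u + (snd (a, b) * \<beta>) *\<^sub>R v = 0"
    have "(\<Sum>w\<in>{u, v}. (if w = u then a * \<alpha> else b * \<beta>) *\<^sub>R w) = 0"
      using eq assms(1) by simp
    then have "\<forall>w\<in>{u, v}. (if w = u then a * \<alpha> else b * \<beta>) = 0"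
      using assms(2) by (intro ballI independentD[of "{u, v}" "{u, v}"]) auto
    then show "(a, b) = 0" using assms by (auto simp: zero_prod_def)
  qed
  then show "bij (\<lambda>z. (fst z * \<alpha>) *\<^sub>R u + (snd z * \<beta>) *\<^sub>R v)"
    using linear_injective_imp_surjective[OF lin] by (simp add: bij_def)
qed

lemma periodic_int_mult:
  fixes f :: "int \<Rightarrow> 'a"
  assumes "\<And>i. f (i + N) = f i"
  shows "f (i + k * N) = f i"
proof (induction k rule: int_induct[where k = 0])
  case (step1 k)
  then show ?case using assms[of "i + k * N"] by (simp add: algebra_simps)
next
  case (step2 k)
  then show ?case using assms[of "i + (k - 1) * N"] by (simp add: algebra_simps)
qed simp

lemma interp_periodic:
  assumes "\<And>i j. V (i + M) j = V i j" "\<And>i j. V i (j + L) = V i j"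
  shows "interp V (s + of_int (k * M), t + of_int (l * L)) = interp V (s, t)"
proof -
  have 1: "V (i + k * M) j = V i j" for i j k
    using periodic_int_mult[of "\<lambda>i. V i j" M i k] assms(1) by simp
  have 2: "V i (j + l * L) = V i j" for i j l
    using periodic_int_mult[of "V i" L j l] assms(2) by simp
  have 4: "V (i + k * M + 1) j' = V (i + 1) j'" for i j'
    using 1[of "i + 1" k j'] by (simp add: algebra_simps)
  have 5: "V i' (j + l * L + 1) = V i' (j + 1)" for i' j
    using 2[of i' "j + 1" l] by (simp add: algebra_simps)
  have fl: "\<lfloor>r + of_int m\<rfloor> = \<lfloor>r\<rfloor> + m" "frac (r + of_int m) = frac r" for r :: real and m
    by (simp_all add: frac_def)
  show ?thesis unfolding interp_def fst_conv snd_conv fl by (simp add: patch_def 1 2 4 5)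
qed

text \<open>Reduces the construction to a doubly periodic grid of vertices. Periodicity lets the
  interpolant descend to the torus, isotropy is one equation per triangle, and injectivity at
  parameter distance below 1 gives local injectivity.\<close>

lemma pl_isotropic_torus_range_interp:
  fixes V :: "int \<Rightarrow> int \<Rightarrow> 'n::finite phase_space"
  assumes p: "lattice_covering p"
    and pos: "M > 0" "L > 0"
    and per: "\<And>i j. V (i + M) j = V i j" "\<And>i j. V i (j + L) = V i j"
    and iso_lower: "\<And>i j. symplectic_form (V (i + 1) j - V i j) (V (i + 1) (j + 1) - V (i + 1) j) = 0"
    and iso_upper: "\<And>i j. symplectic_form (V (i + 1) (j + 1) - V i (j + 1)) (V i (j + 1) - V i j) = 0"
    and inj: "\<And>s t s' t'. \<lbrakk>\<bar>s - s'\<bar> < 1; \<bar>t - t'\<bar> < 1; interp V (s, t) = interp V (s', t')\<rbrakk>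
      \<Longrightarrow> s = s' \<and> t = t'"
  shows "pl_isotropic_torus p (range (interp V))"
proof -
  have covering: "covering_space UNIV p std_torus"
    using p by (simp add: lattice_covering_def)
  obtain \<Gamma> where \<Gamma>: "plane_lattice \<Gamma>" "deck_transformations p = (\<lambda>\<gamma> x. x + \<gamma>) ` \<Gamma>"
    using p unfolding lattice_covering_def by blast
  obtain u v where uv: "u \<noteq> v" "independent {u, v}"
    and \<Gamma>_eq: "\<Gamma> = {of_int i *\<^sub>R u + of_int j *\<^sub>R v | i j :: int. True}"
    using \<Gamma>(1) unfolding plane_lattice_def by blast
  \<comment> \<open>Scaled so that the period rectangle of size \<open>M\<close> by \<open>L\<close>
    becomes a fundamental parallelogram of \<open>\<Gamma>\<close>.\<close>
  define B where "B = (\<lambda>z::plane. (fst z * (1 / of_int M)) *\<^sub>R u + (snd z * (1 / of_int L)) *\<^sub>R v)"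
  have nz: "1 / real_of_int M \<noteq> 0" "1 / real_of_int L \<noteq> 0" using pos by auto
  have linB: "linear B" and bijB: "bij B"
    unfolding B_def by (rule plane_basis_isomorphism[OF uv nz])+
  define A where "A = inv B"
  have AB: "A (B z) = z" and BA: "B (A z) = z" for z
    using bijB by (simp_all add: A_def bij_is_inj bij_is_surj surj_f_inv_f)
  have linA: "linear A"
    unfolding A_def using linB bijB bij_is_inj inj_linear_imp_inv_linear by blast
  have contA: "continuous_on UNIV A"
    using linA by (simp add: linear_continuous_on linear_conv_bounded_linear)
  define G where "G = interp V \<circ> A"
  have G_per: "G (x + \<gamma>) = G x" if \<gamma>: "\<gamma> \<in> \<Gamma>" for x \<gamma>
  proof -
    obtain i j where ij: "\<gamma> = of_int i *\<^sub>R u + of_int j *\<^sub>R v" using \<gamma> \<Gamma>_eq by blast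
    have "\<gamma> = B (of_int (i * M), of_int (j * L))" using pos by (simp add: B_def ij)
    then have "A (x + \<gamma>) = A x + (of_int (i * M), of_int (j * L))"
      by (simp only: linear_add[OF linA] AB)
    then show ?thesis
      using interp_periodic[of V M L "fst (A x)" i "snd (A x)" j, OF per]
      by (simp add: G_def plus_prod_def)
  qed
  \<comment> \<open>The choice of preimage is immaterial, since \<open>G\<close> is invariant under
    \<open>\<Gamma>\<close> and points of one fibre differ by elements of
    \<open>\<Gamma>\<close>.\<close>
  define l where "l = (\<lambda>q. G (SOME x. p x = q))"
  have lp: "l (p x) = G x" for x
  proof -
    have "p (SOME y. p y = p x) = p x" by (rule someI[of "\<lambda>y. p y = p x" x]) simp
    then have "x - (SOME y. p y = p x) \<in> \<Gamma>" by (rule lattice_covering_fibre[OF p \<Gamma>(2)])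
    from G_per[OF this, of "SOME y. p y = p x"] show ?thesis by (simp add: l_def)
  qed
  have lp': "l \<circ> p = G" by (simp add: fun_eq_iff lp)
  have surj_p: "p ` UNIV = std_torus" by (rule covering_space_imp_surjective[OF covering])
  have range: "l ` std_torus = range (interp V)"
  proof -
    have "l ` std_torus = range G" by (simp only: surj_p[symmetric] image_comp lp')
    also have "\<dots> = interp V ` range A" by (simp only: G_def image_comp)
    also have "range A = UNIV" using AB by (metis surj_def)
    finally show ?thesis .
  qed
  have "locally_injective_on std_torus l"
    unfolding locally_injective_on_def
  proof
    fix q assume "q \<in> std_torus"
    then obtain x where x: "q = p x" using surj_p by blast
    \<comment> \<open>An open square of side 1: any two of its points differ by less than 1 in each
      coordinate, as \<open>inj\<close> demands. Its preimage has an open image because coverings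
      are open maps.\<close>
    define W where "W = {fst (A x) - 1/2 <..< fst (A x) + 1/2} \<times> {snd (A x) - 1/2 <..< snd (A x) + 1/2}"
    have "open W" by (simp add: W_def open_Times)
    then have "open (A -` W)" using contA by (simp add: open_vimage)
    then have "openin (top_of_set std_torus) (p ` (A -` W))"
      by (intro covering_space_open_map[OF covering]) simp
    moreover have "A x \<in> W" by (simp add: W_def mem_Times_iff)
    then have "q \<in> p ` (A -` W)" using x by blast
    moreover have "inj_on l (p ` (A -` W))"
    proof (rule inj_onI)
      fix q1 q2 assume "q1 \<in> p ` (A -` W)" "q2 \<in> p ` (A -` W)" and eq: "l q1 = l q2"
      then obtain y1 y2 where y: "q1 = p y1" "q2 = p y2" "A y1 \<in> W" "A y2 \<in> W" by blast
      have "\<bar>fst (A y1) - fst (A y2)\<bar> < 1" "\<bar>snd (A y1) - snd (A y2)\<bar> < 1"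
        using y(3,4) unfolding W_def mem_Times_iff greaterThanLessThan_iff abs_less_iff by linarith+
      moreover have "interp V (fst (A y1), snd (A y1)) = interp V (fst (A y2), snd (A y2))"
        using eq unfolding y(1,2) lp by (simp add: G_def)
      ultimately have "A y1 = A y2" using inj by (simp add: prod_eq_iff)
      then have "y1 = y2" using BA by metis
      then show "q1 = q2" using y by simp
    qed
    ultimately show "\<exists>U. openin (top_of_set std_torus) U \<and> q \<in> U \<and> inj_on l U" by blast
  qed
  moreover
  define K where "K = (`) B ` freudenthal"
  have K: "plane_triangulation K"
    unfolding K_def by (rule plane_triangulation_linear_image[OF plane_triangulation_freudenthal linB bijB])
  \<comment> \<open>Shown for simplices of every dimension, because the pasting argument for
    continuity runs over all of \<open>K\<close>.\<close>
  have affine: "\<exists>P c. linear P \<and> (\<forall>z\<in>S. G z = P z + c) \<and> (\<forall>a b. symplectic_form (P a) (P b) = 0)"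
    if "S \<in> K" for S
  proof -
    obtain F where "F \<in> freudenthal" and SF: "S = B ` F"
      using \<open>S \<in> K\<close> unfolding K_def by blast
    then obtain i j d where F: "d \<in> {i - j - 1, i - j}" "F face_of cell i j d"
      unfolding freudenthal_def by (elim CollectE exE conjE)
    obtain P Q c
      where PQ: "\<And>z. z \<in> cell i j d \<Longrightarrow> interp V z = fst z *\<^sub>R P + snd z *\<^sub>R Q + c"
        "P = V (i + 1) j - V i j \<and> Q = V (i + 1) (j + 1) - V (i + 1) j \<or>
         P = V (i + 1) (j + 1) - V i (j + 1) \<and> Q = V i (j + 1) - V i j"
      by (rule interp_cell[OF F(1), of V]) blast
    have "symplectic_form P Q = 0" using PQ(2) iso_lower iso_upper by auto
    define R where "R = (\<lambda>z. fst (A z) *\<^sub>R P + snd (A z) *\<^sub>R Q)"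
    have "linear R"
      unfolding R_def
      by (intro linearI) (simp_all add: linear_add[OF linA] linear_scale[OF linA] algebra_simps)
    moreover have "G z = R z + c" if "z \<in> S" for z
    proof -
      obtain w where "w \<in> F" "z = B w" using \<open>z \<in> S\<close> SF by blast
      then have "A z \<in> cell i j d" using F(2) face_of_imp_subset AB by auto
      then show ?thesis by (simp add: G_def R_def PQ(1))
    qed
    moreover have "symplectic_form (R a) (R b) = 0" for a b
      by (simp add: R_def symplectic_form_linear_combination \<open>symplectic_form P Q = 0\<close>)
    ultimately show ?thesis by blast
  qed
  have "affine_map_on S G" if "S \<in> K" for S
    using affine[OF that] unfolding affine_map_on_def by blast
  then have "piecewise_linear_wrt K G"
    unfolding piecewise_linear_wrt_def using K piecewise_affine_imp_continuous by blast
  moreover have "isotropic_wrt K G"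
    unfolding isotropic_wrt_def
  proof (intro ballI impI)
    fix S x assume "S \<in> K" "x \<in> interior S"
    then show "isotropic_at G x" using affine[OF \<open>S \<in> K\<close>] isotropic_at_affine by metis
  qed
  ultimately have "pl_isotropic_immersion p l"
    unfolding pl_isotropic_immersion_def lp' by blast
  then show ?thesis unfolding pl_isotropic_torus_def using range by blast
qed

subsection \<open>Thin isotropic tubes around closed polygons\<close>

definition interp1 :: "(int \<Rightarrow> 'b::real_vector) \<Rightarrow> real \<Rightarrow> 'b"
  where "interp1 \<alpha> s = \<alpha> \<lfloor>s\<rfloor> + frac s *\<^sub>R (\<alpha> (\<lfloor>s\<rfloor> + 1) - \<alpha> \<lfloor>s\<rfloor>)"

lemma interp1_eq:
  assumes "of_int i \<le> s" "s \<le> of_int i + 1"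
  shows "interp1 \<alpha> s = \<alpha> i + (s - of_int i) *\<^sub>R (\<alpha> (i + 1) - \<alpha> i)"
proof (cases "s = of_int i + 1")
  case True
  then have "\<lfloor>s\<rfloor> = i + 1" "frac s = 0" by (auto simp: frac_def)
  then show ?thesis using True by (simp add: interp1_def)
next
  case False
  then have "\<lfloor>s\<rfloor> = i" using assms by (intro floor_unique) auto
  then show ?thesis by (simp add: interp1_def frac_def)
qed

text \<open>Here both horizontal differences of a square are equal, and their coefficients add up to
  the horizontal parameter, so the diagonal leaves no trace.\<close>

lemma interp_sum:
  "interp (\<lambda>i j. \<alpha> i + \<beta> j) (s, t) = interp1 \<alpha> s + interp1 \<beta> t"
proof -
  have m: "max (a - b) 0 + min a b = a" for a b :: real by (simp add: max_def min_def)
  have "max (a - b) 0 *\<^sub>R x + min a b *\<^sub>R x = a *\<^sub>R x" for a b :: real and x :: 'a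
    by (simp only: scaleR_left_distrib[symmetric] m)
  then show ?thesis by (simp add: interp_def interp1_def patch_def add.assoc)
qed

lemma interp_linear:
  assumes "linear f"
  shows "f (interp V z) = interp (\<lambda>i j. f (V i j)) z"
  by (simp add: interp_def patch_def linear_add[OF assms] linear_diff[OF assms] linear_scale[OF assms])

text \<open>Both horizontal coefficients are nondecreasing in \<open>a\<close> and their sum is
  \<open>a\<close>, so at least one of them grows strictly. Both differences are positive.\<close>

lemma patch_strict_mono:
  fixes V :: "int \<Rightarrow> int \<Rightarrow> real"
  assumes "V i j < V (i + 1) j" "V i (j + 1) < V (i + 1) (j + 1)" "a < a'"
  shows "patch V i j a b < patch V i j a' b"
proof -
  define p q where "p = V (i + 1) j - V i j" and "q = V (i + 1) (j + 1) - V i (j + 1)"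
  have pos: "p > 0" "q > 0" using assms by (simp_all add: p_def q_def)
  have "max (a - b) 0 * p \<le> max (a' - b) 0 * p" "min a b * q \<le> min a' b * q"
    using pos assms(3) by (auto intro!: mult_right_mono)
  moreover have "max (a - b) 0 * p < max (a' - b) 0 * p \<or> min a b * q < min a' b * q"
    using pos assms(3) by (auto simp: max_def min_def)
  ultimately show ?thesis by (auto simp: patch_def p_def[symmetric] q_def[symmetric])
qed

text \<open>The two functions are the coordinates of a loop running once around a triangle in each
  period 3. Parameters less than 1 apart lie on the same edge or on consecutive edges, where the
  loop is injective.\<close>

lemma triangle_loop_inj:
  assumes "\<bar>t - t'\<bar> < 1"
    and "interp1 (\<lambda>k. of_bool (k mod 3 = 1) :: real) t = interp1 (\<lambda>k. of_bool (k mod 3 = 1)) t'"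
    and "interp1 (\<lambda>k. of_bool (k mod 3 = 2) :: real) t = interp1 (\<lambda>k. of_bool (k mod 3 = 2)) t'"
  shows "t = t'"
proof -
  define p q where "p = interp1 (\<lambda>k. of_bool (k mod 3 = 1) :: real)"
    and "q = interp1 (\<lambda>k. of_bool (k mod 3 = 2) :: real)"
  \<comment> \<open>The three edges in turn: from \<open>(0, 0)\<close> to \<open>(1, 0)\<close>, on
    to \<open>(0, 1)\<close>, and back to the origin.\<close>
  have val: "(j mod 3 = 0 \<and> (j + 1) mod 3 = 1 \<and> p t = t - of_int j \<and> q t = 0) \<or>
      (j mod 3 = 1 \<and> (j + 1) mod 3 = 2 \<and> p t = 1 - (t - of_int j) \<and> q t = t - of_int j) \<or>
      (j mod 3 = 2 \<and> (j + 1) mod 3 = 0 \<and> p t = 0 \<and> q t = 1 - (t - of_int j))"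
    if "of_int j \<le> t" "t \<le> of_int j + 1" for j t
  proof -
    have "(j mod 3 = 0 \<and> (j + 1) mod 3 = 1) \<or> (j mod 3 = 1 \<and> (j + 1) mod 3 = 2) \<or>
        (j mod 3 = 2 \<and> (j + 1) mod 3 = 0)"
      by presburger
    then show ?thesis
      unfolding p_def q_def interp1_eq[OF that] by (elim disjE) simp_all
  qed
  have *: "t = t'"
    if le: "t \<le> t'" "t' < t + 1" and eq: "p t = p t'" "q t = q t'" for t t'
  proof -
    define j where "j = \<lfloor>t\<rfloor>"
    have t: "of_int j \<le> t" "t \<le> of_int j + 1" unfolding j_def by linarith+
    show ?thesis
    proof (cases "t' \<le> of_int j + 1")
      case True
      then have "of_int j \<le> t'" using t le by linarith
      from val[OF t] val[OF this True] show ?thesis using eq by (elim disjE conjE; linarith)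
    next
      case False
      then have t': "of_int (j + 1) \<le> t'" "t' \<le> of_int (j + 1) + 1" using t le by simp_all
      have j: "real_of_int (j + 1) = of_int j + 1" by simp
      from val[OF t] val[OF t'] show ?thesis using eq t t' unfolding j by (elim disjE conjE; linarith)
    qed
  qed
  show ?thesis
  proof (cases "t \<le> t'")
    case True
    then show ?thesis using *[of t t'] assms unfolding p_def q_def by linarith
  next
    case False
    then show ?thesis using *[of t' t] assms unfolding p_def q_def by linarith
  qed
qed

text \<open>Moves are the intervals \<open>[I, I + 1]\<close> with \<open>I\<close> even, pauses
  those with \<open>I\<close> odd. Parameters less than 1 apart lie in the same interval or in
  adjacent ones.\<close>

lemma interp_tube_inj:
  fixes V :: "int \<Rightarrow> int \<Rightarrow> 'n::finite phase_space" and e1 e2 e3 :: "real^'n"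
  assumes \<delta>: "\<delta> > 0"
    and Y: "\<And>I k. snd (V I k) = Y I"
    and X2: "\<And>I k. fst (V I k) \<bullet> e2 = X2 I + \<delta> * of_bool (k mod 3 = 1)"
    and X3: "\<And>I k. fst (V I k) \<bullet> e3 = X3 I + \<delta> * of_bool (k mod 3 = 2)"
    and odd: "\<And>I. odd I \<Longrightarrow> Y (I + 1) = Y I \<and> X2 (I + 1) = X2 I \<and> X3 (I + 1) = X3 I"
    and odd_mono: "\<And>I k. odd I \<Longrightarrow> fst (V I k) \<bullet> e1 < fst (V (I + 1) k) \<bullet> e1"
    and even: "\<And>I. even I \<Longrightarrow> Y (I + 1) \<noteq> Y I"
    and st: "\<bar>s - s'\<bar> < 1" "\<bar>t - t'\<bar> < 1" "interp V (s, t) = interp V (s', t')"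
  shows "s = s' \<and> t = t'"
proof -
  have lin: "linear (\<lambda>v::'n phase_space. snd v)" "linear (\<lambda>v::'n phase_space. fst v \<bullet> e)" for e
    by (auto intro!: linearI simp: inner_add_left)
  have snd_interp: "snd (interp V (s, t)) = interp1 Y s" for s t
    using interp_sum[of Y "\<lambda>_. 0" s t] by (simp add: interp_linear[OF lin(1)] Y interp1_def)
  have scale: "interp1 (\<lambda>k. \<delta> * of_bool (k mod 3 = m)) t = \<delta> * interp1 (\<lambda>k. of_bool (k mod 3 = m)) t"
    for t :: real and m :: int
    by (simp add: interp1_def algebra_simps)
  have e2_interp: "fst (interp V (s, t)) \<bullet> e2 = interp1 X2 s + \<delta> * interp1 (\<lambda>k. of_bool (k mod 3 = 1)) t" for s t
    by (simp add: interp_linear[OF lin(2)] X2 interp_sum scale)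
  have e3_interp: "fst (interp V (s, t)) \<bullet> e3 = interp1 X3 s + \<delta> * interp1 (\<lambda>k. of_bool (k mod 3 = 2)) t" for s t
    by (simp add: interp_linear[OF lin(2)] X3 interp_sum scale)
  \<comment> \<open>Once the base points agree, the coordinates along \<open>e2\<close> and
    \<open>e3\<close> reduce to \<open>\<delta>\<close> times the triangle loop.\<close>
  have loop: "t = t'"
    if "\<bar>t - t'\<bar> < 1" "interp V (s, t) = interp V (s', t')" "interp1 X2 s = interp1 X2 s'" "interp1 X3 s = interp1 X3 s'"
    for s s' t t'
  proof (rule triangle_loop_inj[OF that(1)])
    have "fst (interp V (s, t)) \<bullet> e2 = fst (interp V (s', t')) \<bullet> e2"
      "fst (interp V (s, t)) \<bullet> e3 = fst (interp V (s', t')) \<bullet> e3"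
      using that(2) by simp_all
    then show "interp1 (\<lambda>k. of_bool (k mod 3 = 1) :: real) t = interp1 (\<lambda>k. of_bool (k mod 3 = 1)) t'"
      "interp1 (\<lambda>k. of_bool (k mod 3 = 2) :: real) t = interp1 (\<lambda>k. of_bool (k mod 3 = 2)) t'"
      unfolding e2_interp e3_interp using that(3,4) \<delta> by simp_all
  qed
  have even_interp1: "s = s'"
    if "even I" "of_int I \<le> s" "s \<le> of_int I + 1" "of_int I \<le> s'" "s' \<le> of_int I + 1"
      "interp1 Y s = interp1 Y s'" for I s s'
    using that(6) even[OF that(1)] unfolding interp1_eq[OF that(2,3)] interp1_eq[OF that(4,5)] by simp
  have odd_interp1: "interp1 Y s = Y I \<and> interp1 X2 s = X2 I \<and> interp1 X3 s = X3 I"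
    if "odd I" "of_int I \<le> s" "s \<le> of_int I + 1" for I s
    using odd[OF that(1)] unfolding interp1_eq[OF that(2,3)] by simp
  have same: "s = s' \<and> t = t'"
    if s: "of_int I \<le> s" "s \<le> of_int I + 1" "of_int I \<le> s'" "s' \<le> of_int I + 1"
      and t: "\<bar>t - t'\<bar> < 1" and eq: "interp V (s, t) = interp V (s', t')" for I s s' t t'
  proof (cases "even I")
    case True
    have "s = s'" using even_interp1[OF True s] eq by (metis snd_interp)
    then show ?thesis using loop[OF t eq] by simp
  next
    case False
    note o1 = odd_interp1[OF False s(1,2)] and o2 = odd_interp1[OF False s(3,4)]
    have "t = t'" using loop[OF t eq] o1 o2 by simp
    define j where "j = \<lfloor>t\<rfloor>"
    have j: "of_int j \<le> t" "t \<le> of_int j + 1" unfolding j_def by linarith+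
    define g where "g = (\<lambda>I k. fst (V I k) \<bullet> e1)"
    have g: "fst (interp V (r, t)) \<bullet> e1 = patch g I j (r - of_int I) (t - of_int j)"
      if "of_int I \<le> r" "r \<le> of_int I + 1" for r
      unfolding interp_linear[OF lin(2)] g_def by (rule interp_eq_patch[OF that j])
    have "patch g I j (s - of_int I) (t - of_int j) = patch g I j (s' - of_int I) (t - of_int j)"
      using g[OF s(1,2)] g[OF s(3,4)] eq \<open>t = t'\<close> by simp
    \<comment> \<open>For fixed \<open>t\<close> the coordinate along \<open>e1\<close> increases
      strictly during a pause, since it does so along both horizontal edges of the square.\<close>
    moreover have "patch g I j a (t - of_int j) < patch g I j a' (t - of_int j)" if "a < a'" for a a'
      using that odd_mono[OF False] by (intro patch_strict_mono) (simp_all add: g_def)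
    ultimately have "\<not> s < s'" "\<not> s' < s" by (metis diff_strict_right_mono less_irrefl)+
    then have "s = s'" by simp
    then show ?thesis using \<open>t = t'\<close> by simp
  qed
  have main: "s = s' \<and> t = t'"
    if le: "s \<le> s'" "s' < s + 1" and t: "\<bar>t - t'\<bar> < 1" and eq: "interp V (s, t) = interp V (s', t')"
    for s s' t t'
  proof -
    define I where "I = \<lfloor>s\<rfloor>"
    have s: "of_int I \<le> s" "s \<le> of_int I + 1" unfolding I_def by linarith+
    show ?thesis
    proof (cases "s' \<le> of_int I + 1")
      case True
      then have "of_int I \<le> s'" using s le by linarith
      then show ?thesis using same[OF s _ True t eq] by simp
    next
      case False
      then have s': "of_int (I + 1) \<le> s'" "s' \<le> of_int (I + 1) + 1" using s le by simp_all
      have Yeq: "interp1 Y s = interp1 Y s'" using eq by (metis snd_interp)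
      have end1: "interp1 Y (of_int (I + 1)) = Y (I + 1)" by (simp add: interp1_def)
      show ?thesis
      \<comment> \<open>One of two adjacent intervals is a pause, on which \<open>y\<close> is
        constant. As \<open>y\<close> is injective on the move, the parameter in the move must be
        the common endpoint.\<close>
      proof (cases "even I")
        case True
        then have "interp1 Y s' = Y (I + 1)" using odd_interp1[OF _ s'] by simp
        then have "s = of_int (I + 1)"
          using Yeq end1 by (intro even_interp1[OF True s]) simp_all
        then show ?thesis using same[of "I + 1" s s' t t'] s' t eq by simp
      next
        case odd': False
        have "interp1 Y s = Y (I + 1)" using odd_interp1[OF odd' s] odd[OF odd'] by simp
        then have "s' = of_int (I + 1)"
          using Yeq end1 odd' by (intro even_interp1[OF _ s']) simp_all
        then show ?thesis using False by simp
      qed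
    qed
  qed
  show ?thesis
  proof (cases "s \<le> s'")
    case True
    then show ?thesis using main[OF _ _ st(2,3)] st(1) by linarith
  next
    case False
    moreover have "\<bar>t' - t\<bar> < 1" using st(2) by (simp add: abs_minus_commute)
    ultimately have "s' = s \<and> t' = t" using main[OF _ _ _ st(3)[symmetric]] st(1) by linarith
    then show ?thesis by simp
  qed
qed

section \<open>Construction of the tube\<close>

lemma finite_range_periodic_int:
  fixes f :: "int \<Rightarrow> 'a"
  assumes "N > 0" "\<And>i. f (i + N) = f i"
  shows "finite (range f)"
proof (rule finite_subset)
  have "f i = f (i mod N)" for i
    using periodic_int_mult[of f N "i mod N" "i div N", OF assms(2)] by (simp add: mult.commute)
  moreover have "i mod N \<in> {0..<N}" for i using assms(1) by simp
  ultimately show "range f \<subseteq> f ` {0..<N}" by blast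
qed simp

text \<open>Of two consecutive terms exactly one is shifted, so equality would force
  \<open>\<rho>\<close> to be the absolute value of a difference of neighbours. By periodicity only
  finitely many values have to be avoided.\<close>

lemma generic_alternating_perturbation:
  fixes z :: "int \<Rightarrow> real"
  assumes "N > 0" "\<And>i. z (i + N) = z i" "\<mu> > 0"
  obtains \<rho> where "0 < \<rho>" "\<rho> < \<mu>"
    "\<And>i. z i + (if even i then \<rho> else 0) \<noteq> z (i + 1) + (if even (i + 1) then \<rho> else 0)"
proof -
  have "finite (range (\<lambda>i. \<bar>z (i + 1) - z i\<bar>))"
  proof (rule finite_range_periodic_int[OF assms(1)])
    show "\<bar>z (i + N + 1) - z (i + N)\<bar> = \<bar>z (i + 1) - z i\<bar>" for i
      using assms(2)[of "i + 1"] assms(2)[of i] by (simp add: algebra_simps)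
  qed
  moreover have "infinite {0<..<\<mu>}" using assms(3) by (rule infinite_Ioo)
  ultimately obtain \<rho> where "\<rho> \<in> {0<..<\<mu>}" "\<rho> \<notin> range (\<lambda>i. \<bar>z (i + 1) - z i\<bar>)"
    by (meson finite_subset subsetI)
  then have \<rho>: "0 < \<rho>" "\<rho> < \<mu>" "\<And>i. \<rho> \<noteq> \<bar>z (i + 1) - z i\<bar>" by auto
  show ?thesis
  proof (rule that[OF \<rho>(1,2)])
    show "z i + (if even i then \<rho> else 0) \<noteq> z (i + 1) + (if even (i + 1) then \<rho> else 0)" for i
      using \<rho>(1) \<rho>(3)[of i] by auto
  qed
qed

lemma obtain_three_axes:
  assumes "CARD('n::finite) \<ge> 3"
  obtains e1 e2 e3 :: "real^'n"
  where "norm e1 = 1" "norm e2 = 1" "norm e3 = 1" "e1 \<bullet> e2 = 0" "e1 \<bullet> e3 = 0" "e2 \<bullet> e3 = 0"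
proof -
  obtain T :: "'n set" where "card T = 3" using assms obtain_subset_with_card_n by metis
  then obtain a b c :: 'n where "a \<noteq> b" "a \<noteq> c" "b \<noteq> c" by (auto simp: card_3_iff)
  then show ?thesis using that[of "axis a 1" "axis b 1" "axis c 1"] by (simp add: inner_axis_axis norm_axis_1)
qed

text \<open>Columns \<open>2 * i\<close> and \<open>2 * i + 1\<close> carry the loop before and
  after the move from \<open>z i\<close> to \<open>z (i + 1)\<close>, both times orthogonal to
  \<open>w i\<close>. The pause up to column \<open>2 * i + 2\<close> turns it into the position
  orthogonal to \<open>w (i + 1)\<close>.\<close>

lemma isotropic_tube_around_polygon:
  fixes z :: "int \<Rightarrow> 'n::finite phase_space"
  assumes card: "CARD('n) \<ge> 3"
    and N: "N > 0" "even N" "\<And>i. z (i + N) = z i"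
    and \<mu>: "\<mu> > 0"
  obtains V :: "int \<Rightarrow> int \<Rightarrow> 'n phase_space"
  where "\<And>i j. V (i + 2 * N) j = V i j" "\<And>i j. V i (j + 3) = V i j"
    and "\<And>i j. symplectic_form (V (i + 1) j - V i j) (V (i + 1) (j + 1) - V (i + 1) j) = 0"
    and "\<And>i j. symplectic_form (V (i + 1) (j + 1) - V i (j + 1)) (V i (j + 1) - V i j) = 0"
    and "\<And>s t s' t'. \<lbrakk>\<bar>s - s'\<bar> < 1; \<bar>t - t'\<bar> < 1; interp V (s, t) = interp V (s', t')\<rbrakk>
      \<Longrightarrow> s = s' \<and> t = t'"
    and "\<And>i k. dist (V (2 * i) k) (z i) < \<mu>" "\<And>i k. dist (V (2 * i + 1) k) (z (i + 1)) < \<mu>"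
proof -
  obtain e1 e2 e3 :: "real^'n"
    where n: "norm e1 = 1" "norm e2 = 1" "norm e3 = 1"
      and o: "e1 \<bullet> e2 = 0" "e1 \<bullet> e3 = 0" "e2 \<bullet> e3 = 0"
    using obtain_three_axes[OF card] by blast
  have i1: "e1 \<bullet> e1 = 1" "e2 \<bullet> e2 = 1" "e3 \<bullet> e3 = 1"
    using n by (simp_all add: norm_eq_1)
  have o': "e2 \<bullet> e1 = 0" "e3 \<bullet> e1 = 0" "e3 \<bullet> e2 = 0"
    using o by (simp_all add: inner_commute)
  obtain \<rho> where \<rho>: "0 < \<rho>" "\<rho> < \<mu> / 4"
    and \<rho>_ne: "\<And>i. snd (z i) \<bullet> e1 + (if even i then \<rho> else 0) \<noteq>
      snd (z (i + 1)) \<bullet> e1 + (if even (i + 1) then \<rho> else 0)"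
    using generic_alternating_perturbation[of N "\<lambda>i. snd (z i) \<bullet> e1" "\<mu> / 4"] N \<mu> by auto
  define x where "x i = fst (z i)" for i
  define y where "y i = snd (z i) + (if even i then \<rho> else 0) *\<^sub>R e1" for i
  define w where "w i = y (i + 1) - y i" for i
  have w1: "e1 \<bullet> w i \<noteq> 0" for i
    using \<rho>_ne[of i] by (auto simp: w_def y_def inner_diff_right inner_add_right i1 inner_commute)
  \<comment> \<open>Evenness of \<open>N\<close> keeps the alternating perturbation
    periodic.\<close>
  have xN: "x (i + N) = x i" and yN: "y (i + N) = y i" and wN: "w (i + N) = w i" for i
    using N(2) N(3)[of i] N(3)[of "i + 1"] by (auto simp: x_def y_def w_def add.commute add.left_commute)
  \<comment> \<open>The vertices \<open>0\<close>, \<open>e2\<close>, \<open>e3\<close> of the model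
    triangle. The shear along \<open>e1\<close> in \<open>C\<close> moves them into the hyperplane
    orthogonal to \<open>w i\<close> without changing their coordinates along \<open>e2\<close> and
    \<open>e3\<close>.\<close>
  define c where "c k = (of_bool (k mod 3 = 1) :: real) *\<^sub>R e2 + (of_bool (k mod 3 = 2) :: real) *\<^sub>R e3" for k :: int
  define C where "C i k = c k - ((c k \<bullet> w i) / (e1 \<bullet> w i)) *\<^sub>R e1" for i k
  have C_perp: "C i k \<bullet> w i = 0" for i k
    using w1[of i] by (simp add: C_def inner_diff_left)
  have C_perp': "w i \<bullet> C i k = 0" for i k
    using C_perp by (simp add: inner_commute)
  have norm_c: "norm (c k) \<le> 1" for k
    using n by (auto simp: c_def)
  \<comment> \<open>A bound uniform in \<open>i\<close> exists because \<open>w\<close> is periodic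
    and takes finitely many values.\<close>
  obtain D where D: "D > 0" "\<And>i k. norm (C i k) \<le> D"
  proof -
    define f where "f i = 1 + norm (w i) / \<bar>e1 \<bullet> w i\<bar>" for i
    have "finite (range f)"
      by (rule finite_range_periodic_int[OF N(1)]) (simp add: f_def wN)
    then have f: "f i \<le> Max (range f)" for i by simp
    have "norm (C i k) \<le> f i" for i k
    proof -
      have "\<bar>c k \<bullet> w i\<bar> \<le> norm (w i)"
        using Cauchy_Schwarz_ineq2[of "c k" "w i"] norm_c[of k] mult_right_mono[of "norm (c k)" 1 "norm (w i)"]
        by simp
      then have "\<bar>c k \<bullet> w i\<bar> / \<bar>e1 \<bullet> w i\<bar> \<le> norm (w i) / \<bar>e1 \<bullet> w i\<bar>"
        by (intro divide_right_mono) simp_all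
      moreover have "norm (C i k) \<le> norm (c k) + \<bar>c k \<bullet> w i\<bar> / \<bar>e1 \<bullet> w i\<bar>"
        unfolding C_def by (rule order_trans[OF norm_triangle_ineq4]) (simp add: n)
      ultimately show ?thesis using norm_c[of k] by (simp add: f_def)
    qed
    then have "norm (C i k) \<le> Max (range f)" for i k using f order_trans by blast
    moreover have "f 0 \<ge> 1" by (simp add: f_def)
    then have "Max (range f) > 0" using f[of 0] by linarith
    ultimately show thesis using that by blast
  qed
  \<comment> \<open>With these sizes the scaled loop vertices have norm at most
    \<open>\<mu> / 16\<close>, so the advance \<open>\<tau>\<close> outweighs the tilt at both ends
    of a pause, while loop, advance and perturbation together stay below
    \<open>\<mu>\<close>.\<close>
  define \<delta> where "\<delta> = \<mu> / (16 * D)"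
  define \<tau> where "\<tau> = \<mu> / 4"
  have \<delta>: "\<delta> > 0" using D(1) \<mu> by (simp add: \<delta>_def)
  have \<delta>C: "norm (\<delta> *\<^sub>R C i k) \<le> \<mu> / 16" for i k
  proof -
    have "\<delta> * norm (C i k) \<le> \<delta> * D" using \<delta> D(2) by (intro mult_left_mono) auto
    also have "\<delta> * D = \<mu> / 16" using D(1) by (simp add: \<delta>_def)
    finally show ?thesis using \<delta> by simp
  qed
  \<comment> \<open>A move stops short of its target by \<open>\<tau>\<close> in direction
    \<open>e1\<close>; the following pause makes up for this and thereby advances.\<close>
  define V where "V I k = (let i = I div 2 in
    if even I then (x i + \<delta> *\<^sub>R C i k, y i)
    else (x (i + 1) - \<tau> *\<^sub>R e1 + \<delta> *\<^sub>R C i k, y (i + 1)))" for I k :: int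
  have V0: "V (2 * i) k = (x i + \<delta> *\<^sub>R C i k, y i)"
    and V1: "V (2 * i + 1) k = (x (i + 1) - \<tau> *\<^sub>R e1 + \<delta> *\<^sub>R C i k, y (i + 1))"
    and V2: "V (2 * i + 1 + 1) k = (x (i + 1) + \<delta> *\<^sub>R C (i + 1) k, y (i + 1))" for i k
    by (simp_all add: V_def Let_def add.commute)
  have parity: "(\<exists>i. I = 2 * i) \<or> (\<exists>i. I = 2 * i + 1)" for I :: int
    by presburger
  show ?thesis
  proof (rule that)
    fix I j
    show "V (I + 2 * N) j = V I j"
      using parity[of I]
    proof (elim disjE exE)
      fix i assume "I = 2 * i"
      then have "I + 2 * N = 2 * (i + N)" by simp
      then show ?thesis using \<open>I = 2 * i\<close> V0 by (simp only: V0 xN yN C_def wN)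
    next
      fix i assume I: "I = 2 * i + 1"
      then have "I + 2 * N = 2 * (i + N) + 1" by simp
      moreover have "x (i + N + 1) = x (i + 1)" "y (i + N + 1) = y (i + 1)"
        using xN[of "i + 1"] yN[of "i + 1"] by (simp_all add: algebra_simps)
      ultimately show ?thesis using I by (simp only: V1 C_def wN)
    qed
  next
    fix I j
    have "c (j + 3) = c j" by (simp add: c_def)
    then show "V I (j + 3) = V I j" by (simp only: V_def C_def)
  next
    fix I j
    \<comment> \<open>In a move the vertical difference has no \<open>y\<close> part, and its
      \<open>x\<close> part is orthogonal to the \<open>y\<close> part \<open>w i\<close> of the
      horizontal one. In a pause neither difference has a \<open>y\<close> part.\<close>
    show "symplectic_form (V (I + 1) j - V I j) (V (I + 1) (j + 1) - V (I + 1) j) = 0"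
      using parity[of I]
    proof (elim disjE exE)
      fix i assume "I = 2 * i"
      then show ?thesis
        by (simp add: V0 V1 symplectic_form_def w_def[symmetric] inner_diff_left inner_diff_right C_perp C_perp')
    next
      fix i assume "I = 2 * i + 1"
      then show ?thesis by (simp only: V1 V2) (simp add: symplectic_form_def)
    qed
    show "symplectic_form (V (I + 1) (j + 1) - V I (j + 1)) (V I (j + 1) - V I j) = 0"
      using parity[of I]
    proof (elim disjE exE)
      fix i assume "I = 2 * i"
      then show ?thesis
        by (simp add: V0 V1 symplectic_form_def w_def[symmetric] inner_diff_left inner_diff_right C_perp C_perp')
    next
      fix i assume "I = 2 * i + 1"
      then show ?thesis by (simp only: V1 V2) (simp add: symplectic_form_def)
    qed
  next
    fix i k
    have "dist (V (2 * i) k) (z i) = norm (\<delta> *\<^sub>R C i k, (if even i then \<rho> else 0) *\<^sub>R e1)"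
      by (simp add: V0 dist_norm x_def y_def minus_prod_def)
    also have "\<dots> \<le> norm (\<delta> *\<^sub>R C i k) + norm ((if even i then \<rho> else 0) *\<^sub>R e1)"
      by (rule norm_Pair_le)
    also have "\<dots> < \<mu>" using \<delta>C[of i k] \<rho> \<mu> n by simp
    finally show "dist (V (2 * i) k) (z i) < \<mu>" .
    have "dist (V (2 * i + 1) k) (z (i + 1)) =
        norm (\<delta> *\<^sub>R C i k - \<tau> *\<^sub>R e1, (if even (i + 1) then \<rho> else 0) *\<^sub>R e1)"
      by (simp add: V1 dist_norm x_def y_def minus_prod_def)
    also have "\<dots> \<le> norm (\<delta> *\<^sub>R C i k - \<tau> *\<^sub>R e1) + norm ((if even (i + 1) then \<rho> else 0) *\<^sub>R e1)"
      by (rule norm_Pair_le)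
    also have "norm (\<delta> *\<^sub>R C i k - \<tau> *\<^sub>R e1) \<le> norm (\<delta> *\<^sub>R C i k) + \<tau>"
      by (rule order_trans[OF norm_triangle_ineq4]) (use n \<mu> in \<open>simp add: \<tau>_def\<close>)
    also have "norm (\<delta> *\<^sub>R C i k) + \<tau> + norm ((if even (i + 1) then \<rho> else 0) *\<^sub>R e1) < \<mu>"
      using \<delta>C[of i k] \<rho> \<mu> n by (simp add: \<tau>_def)
    finally show "dist (V (2 * i + 1) k) (z (i + 1)) < \<mu>" by simp
  next
    have C2: "C i k \<bullet> e2 = of_bool (k mod 3 = 1)" and C3: "C i k \<bullet> e3 = of_bool (k mod 3 = 2)" for i k
      by (simp_all add: C_def c_def inner_diff_left inner_add_left o o' i1)
    define Y where "Y I = (if even I then y (I div 2) else y (I div 2 + 1))" for I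
    define X where "X e I = (if even I then x (I div 2) else x (I div 2 + 1)) \<bullet> e" for e I
    fix s t s' t' :: real
    assume st: "\<bar>s - s'\<bar> < 1" "\<bar>t - t'\<bar> < 1" "interp V (s, t) = interp V (s', t')"
    show "s = s' \<and> t = t'"
    proof (rule interp_tube_inj[OF \<delta> _ _ _ _ _ _ st, of Y e2 "X e2" e3 "X e3" e1])
      fix I k
      show "snd (V I k) = Y I" by (simp add: V_def Y_def Let_def)
      show "fst (V I k) \<bullet> e2 = X e2 I + \<delta> * of_bool (k mod 3 = 1)"
        by (simp add: V_def X_def Let_def inner_add_left inner_diff_left C2 o)
      show "fst (V I k) \<bullet> e3 = X e3 I + \<delta> * of_bool (k mod 3 = 2)"
        by (simp add: V_def X_def Let_def inner_add_left inner_diff_left C3 o)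
    next
      fix I :: int assume "odd I"
      then obtain i where I: "I = 2 * i + 1" by (elim oddE)
      have "I div 2 = i" "(I + 1) div 2 = i + 1" by (simp_all add: I)
      then show "Y (I + 1) = Y I \<and> X e2 (I + 1) = X e2 I \<and> X e3 (I + 1) = X e3 I"
        using \<open>odd I\<close> by (simp add: Y_def X_def)
      fix k
      have abs: "\<bar>(\<delta> *\<^sub>R C i k) \<bullet> e1\<bar> \<le> \<mu> / 16" for i
        using Cauchy_Schwarz_ineq2[of "\<delta> *\<^sub>R C i k" e1] \<delta>C[of i k] n(1) by (simp only: mult_1_right)
      have "fst (V I k) \<bullet> e1 = x (i + 1) \<bullet> e1 - \<tau> + (\<delta> *\<^sub>R C i k) \<bullet> e1"
        unfolding I V1 by (simp add: inner_add_left inner_diff_left i1)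
      moreover have "fst (V (I + 1) k) \<bullet> e1 = x (i + 1) \<bullet> e1 + (\<delta> *\<^sub>R C (i + 1) k) \<bullet> e1"
        unfolding I V2 by (simp add: inner_add_left)
      ultimately show "fst (V I k) \<bullet> e1 < fst (V (I + 1) k) \<bullet> e1"
        using abs[of i] abs[of "i + 1"] \<mu> unfolding \<tau>_def by linarith
    next
      fix I :: int assume "even I"
      then obtain i where I: "I = 2 * i" by (elim evenE)
      have "w i \<noteq> 0" using w1[of i] by auto
      then show "Y (I + 1) \<noteq> Y I" by (simp add: Y_def I w_def)
    qed
  qed
qed

subsection \<open>Hausdorff approximation\<close>

text \<open>On each of its two triangles the patch is a convex combination of the three corner
  values.\<close>

lemma patch_mem_convex:
  assumes "convex S" "V i j \<in> S" "V i (j + 1) \<in> S" "V (i + 1) j \<in> S" "V (i + 1) (j + 1) \<in> S"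
    and ab: "0 \<le> a" "a \<le> 1" "0 \<le> b" "b \<le> 1"
  shows "patch V i j a b \<in> S"
proof -
  have comb: "u *\<^sub>R p + v *\<^sub>R q + w *\<^sub>R r \<in> S"
    if "p \<in> S" "q \<in> S" "r \<in> S" "0 \<le> u" "0 \<le> v" "0 \<le> w" "u + v + w = 1" for p q r u v w
  proof -
    have "u *\<^sub>R p + v *\<^sub>R q + w *\<^sub>R r \<in> convex hull {p, q, r}"
      using that(4-) unfolding convex_hull_3 by blast
    also have "\<dots> \<subseteq> S" using that(1-3) assms(1) by (intro hull_minimal) auto
    finally show ?thesis .
  qed
  show ?thesis
  proof (cases "b \<le> a")
    case True
    then have "patch V i j a b = (1 - a) *\<^sub>R V i j + (a - b) *\<^sub>R V (i + 1) j + b *\<^sub>R V (i + 1) (j + 1)"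
      by (simp add: patch_def algebra_simps)
    then show ?thesis using comb[of "V i j" "V (i + 1) j" "V (i + 1) (j + 1)" "1 - a" "a - b" b] assms True by simp
  next
    case False
    then have "patch V i j a b = (1 - b) *\<^sub>R V i j + (b - a) *\<^sub>R V i (j + 1) + a *\<^sub>R V (i + 1) (j + 1)"
      by (simp add: patch_def max_def min_def algebra_simps)
    then show ?thesis using comb[of "V i j" "V i (j + 1)" "V (i + 1) (j + 1)" "1 - b" "b - a" a] assms False by simp
  qed
qed

section \<open>Sampling a doubly periodic map along a closed chain\<close>

lemma doubly_periodic_uniformly_continuous:
  fixes f :: "plane \<Rightarrow> 'b::metric_space"
  assumes cont: "continuous_on UNIV f"
    and per: "\<And>x (i::int) (j::int). f (x + (of_int i, of_int j)) = f x"
  shows "uniformly_continuous_on UNIV f"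
  unfolding uniformly_continuous_on_def
proof (intro allI impI)
  fix e :: real assume "e > 0"
  \<comment> \<open>The unit square with a margin of 1: an integer translation takes
    \<open>x\<close> into the unit square, and \<open>x'\<close>, being less than 1 away, stays
    inside \<open>Q\<close>.\<close>
  define Q :: "plane set" where "Q = cbox (-1, -1) (2, 2)"
  have "uniformly_continuous_on Q f"
    using cont unfolding Q_def
    by (intro compact_uniformly_continuous) (auto intro: continuous_on_subset)
  then obtain d where d: "d > 0" "\<And>x x'. x \<in> Q \<Longrightarrow> x' \<in> Q \<Longrightarrow> dist x' x < d \<Longrightarrow> dist (f x') (f x) < e"
    using \<open>e > 0\<close> unfolding uniformly_continuous_on_def by metis
  have "dist (f x') (f x) < e" if "dist x' x < min d 1" for x x' :: plane
  proof -
    define g :: plane where "g = (of_int (- \<lfloor>fst x\<rfloor>), of_int (- \<lfloor>snd x\<rfloor>))"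
    have "\<bar>fst x' - fst x\<bar> \<le> dist x' x" "\<bar>snd x' - snd x\<bar> \<le> dist x' x"
      using dist_fst_le[of x' x] dist_snd_le[of x' x] by (simp_all add: dist_real_def)
    then have "\<bar>fst x' - fst x\<bar> < 1" "\<bar>snd x' - snd x\<bar> < 1" using that by simp_all
    moreover have "0 \<le> fst x - \<lfloor>fst x\<rfloor>" "fst x - \<lfloor>fst x\<rfloor> \<le> 1" "0 \<le> snd x - \<lfloor>snd x\<rfloor>" "snd x - \<lfloor>snd x\<rfloor> \<le> 1"
      by linarith+
    ultimately have "x + g \<in> Q" "x' + g \<in> Q"
      unfolding Q_def g_def cbox_interval atLeastAtMost_iff less_eq_prod_def fst_add snd_add
        fst_conv snd_conv of_int_minus by (intro conjI; linarith)+
    then have "dist (f (x' + g)) (f (x + g)) < e" using d(2) that by simp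
    then show ?thesis unfolding g_def per .
  qed
  then show "\<exists>d>0. \<forall>x\<in>UNIV. \<forall>x'\<in>UNIV. dist x' x < d \<longrightarrow> dist (f x') (f x) < e"
    using d(1) by (intro exI[of _ "min d 1"]) simp
qed

lemma dense_closed_chain:
  fixes f :: "plane \<Rightarrow> 'b::metric_space"
  assumes cont: "continuous_on UNIV f"
    and per: "\<And>x (i::int) (j::int). f (x + (of_int i, of_int j)) = f x"
    and "\<mu> > 0"
  obtains z :: "int \<Rightarrow> 'b" and N :: int
  where "N > 0" "even N" "\<And>i. z (i + N) = z i" "\<And>i. z i \<in> range f"
    "\<And>i. dist (z i) (z (i + 1)) < \<mu>" "\<And>x. \<exists>i. dist (f x) (z i) < \<mu>"
proof -
  obtain d where d: "d > 0" "\<And>x x'. dist x' x < d \<Longrightarrow> dist (f x') (f x) < \<mu>"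
    using doubly_periodic_uniformly_continuous[OF cont per] \<open>\<mu> > 0\<close>
    unfolding uniformly_continuous_on_def by (metis UNIV_I)
  obtain k :: nat where k: "k > 0" "2 / d < real k"
    using reals_Archimedean2[of "max 1 (2 / d)"] by (metis max_less_iff_conj of_nat_0_less_iff zero_less_one order.strict_trans)
  \<comment> \<open>The factor 2 makes the number \<open>m * m\<close> of steps even, as the
    alternating perturbation requires.\<close>
  define m where "m = 2 * int k"
  have m: "m > 0" "even m" using k by (simp_all add: m_def)
  have md: "2 / real_of_int m < d" using k d(1) by (simp add: m_def field_simps)
  have close: "dist (f (a', b')) (f (a, b)) < \<mu>" if "\<bar>a' - a\<bar> \<le> 1 / of_int m" "\<bar>b' - b\<bar> \<le> 1 / of_int m" for a a' b b'
  proof (rule d(2))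
    have "dist (a', b') (a, b) = norm (a' - a, b' - b)" by (simp add: dist_norm)
    also have "\<dots> \<le> \<bar>a' - a\<bar> + \<bar>b' - b\<bar>" using norm_Pair_le[of "a' - a" "b' - b"] by simp
    also have "\<dots> \<le> 2 / real_of_int m" using that by simp
    finally show "dist (a', b') (a, b) < d" using md by simp
  qed
  \<comment> \<open>The line of slope \<open>1 / m\<close> closes up after \<open>m * m\<close> steps and meets every small square.\<close>
  define z where "z i = f (of_int i / of_int m, of_int i / of_int (m * m))" for i
  show ?thesis
  proof (rule that[of "m * m" z])
    show "m * m > 0" "even (m * m)" using m by simp_all
    show "z (i + m * m) = z i" for i
      using per[of "(of_int i / of_int m, of_int i / of_int (m * m))" m 1] m(1)
      by (simp add: z_def add_divide_distrib)
    show "z i \<in> range f" for i by (simp add: z_def)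
    show "dist (z i) (z (i + 1)) < \<mu>" for i
      unfolding z_def
    proof (rule close)
      have "1 / real_of_int (m * m) \<le> 1 / real_of_int m"
        using m(1) by (simp add: field_simps)
      then show "\<bar>of_int i / of_int (m * m) - of_int (i + 1) / of_int (m * m)\<bar> \<le> 1 / real_of_int m"
        using m(1) by (simp add: add_divide_distrib)
    qed (use m(1) in \<open>simp add: add_divide_distrib\<close>)
    show "\<exists>i. dist (f x) (z i) < \<mu>" for x
    proof -
      define a b where "a = frac (fst x)" and "b = frac (snd x)"
      have ab: "0 \<le> a" "a < 1" "0 \<le> b" "b < 1" by (simp_all add: a_def b_def frac_lt_1)
      have fx: "f x = f (a, b)"
        using per[of "(a, b)" "\<lfloor>fst x\<rfloor>" "\<lfloor>snd x\<rfloor>"] by (simp add: a_def b_def frac_def)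
      define p q where "p = \<lfloor>a * of_int m\<rfloor>" and "q = \<lfloor>b * of_int m\<rfloor>"
      have p: "real_of_int p \<le> a * of_int m" "a * of_int m < real_of_int p + 1"
        and q: "real_of_int q \<le> b * of_int m" "b * of_int m < real_of_int q + 1"
        unfolding p_def q_def by linarith+
      have "p \<ge> 0" using ab m(1) by (simp add: p_def)
      have "a * of_int m < of_int m" using ab m(1) by simp
      then have "real_of_int p < of_int m" using p by linarith
      have *: "\<bar>r / of_int m - c\<bar> \<le> 1 / of_int m" if "\<bar>r - c * of_int m\<bar> \<le> 1" for r c :: real
      proof -
        have "r / of_int m - c = (r - c * of_int m) / of_int m" using m(1) by (simp add: field_simps)
        then show ?thesis using that m(1) by (simp add: divide_right_mono)
      qed
      \<comment> \<open>After \<open>q\<close> full turns in the first coordinate and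
        \<open>p\<close> further steps, the line is at \<open>p / m\<close> modulo 1 in the first
        coordinate and between \<open>q / m\<close> and \<open>(q + 1) / m\<close> in the
        second.\<close>
      have "z (q * m + p) = f (of_int p / of_int m, of_int (q * m + p) / of_int (m * m))"
        using per[of "(of_int p / of_int m, of_int (q * m + p) / of_int (m * m))" q 0] m(1)
        by (simp add: z_def add_divide_distrib add.commute)
      also have "dist \<dots> (f (a, b)) < \<mu>"
      proof (rule close)
        show "\<bar>of_int p / of_int m - a\<bar> \<le> 1 / of_int m" using p by (intro *) linarith
        have "of_int (q * m + p) / of_int (m * m) = (of_int q + of_int p / real_of_int m) / of_int m"
          using m(1) by (simp add: field_simps)
        moreover have "0 \<le> of_int p / real_of_int m" "of_int p / real_of_int m \<le> 1"
          using \<open>p \<ge> 0\<close> \<open>real_of_int p < of_int m\<close> m(1) by simp_all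
        then have "\<bar>(of_int q + of_int p / real_of_int m) / of_int m - b\<bar> \<le> 1 / of_int m"
          using q by (intro *) linarith
        ultimately show "\<bar>of_int (q * m + p) / of_int (m * m) - b\<bar> \<le> 1 / of_int m" by simp
      qed
      finally show ?thesis using fx by (metis dist_commute)
    qed
  qed
qed

lemma hausdorff_dist_le:
  assumes "S \<noteq> {}" "T \<noteq> {}" "\<And>x. x \<in> S \<Longrightarrow> \<exists>y\<in>T. dist x y \<le> e" "\<And>y. y \<in> T \<Longrightarrow> \<exists>x\<in>S. dist y x \<le> e"
  shows "hausdorff_dist S T \<le> e"
  unfolding hausdorff_dist_def
proof (intro max.boundedI cSUP_least)
  show "infdist x T \<le> e" if "x \<in> S" for x using assms(3)[OF that] infdist_le2 by blast
  show "infdist y S \<le> e" if "y \<in> T" for y using assms(4)[OF that] infdist_le2 by blast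
qed (use assms in auto)

lemma smooth_isotropic_torus_param:
  assumes "smooth_isotropic_torus \<Sigma>"
  obtains f :: "plane \<Rightarrow> 'n::finite phase_space"
  where "continuous_on UNIV f" "\<And>x (i::int) (j::int). f (x + (of_int i, of_int j)) = f x" "\<Sigma> = range f"
proof -
  obtain l where l: "smooth_isotropic_immersion l" "\<Sigma> = l ` std_torus"
    using assms by (auto simp: smooth_isotropic_torus_def)
  have "times_cont_differentiable 0 (l \<circ> torus_param)"
    using l(1) unfolding smooth_isotropic_immersion_def smooth_map_def by blast
  then have cont: "continuous_on UNIV (l \<circ> torus_param)" by simp
  have cis: "cis (2 * pi * (r + of_int i)) = cis (2 * pi * r)" for r :: real and i :: int
    by (simp add: cis_mult[symmetric] cis_multiple_2pi distrib_left)
  have per: "(l \<circ> torus_param) (x + (of_int i, of_int j)) = (l \<circ> torus_param) x" for x and i j :: int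
    by (simp add: torus_param_def cis)
  have circle: "\<exists>r. w = cis (2 * pi * r)" if "norm w = 1" for w :: complex
  proof -
    have "w = cis (2 * pi * (Arg w / (2 * pi)))"
      using that rcis_cmod_Arg[of w] by (simp add: rcis_def)
    then show ?thesis by blast
  qed
  have "range torus_param = std_torus"
  proof (intro equalityI subsetI)
    fix q assume "q \<in> std_torus"
    then have "norm (fst q) = 1" "norm (snd q) = 1" by (auto simp: std_torus_def)
    then obtain r s where "fst q = cis (2 * pi * r)" "snd q = cis (2 * pi * s)" using circle by metis
    then have "q = torus_param (r, s)" by (simp add: torus_param_def prod_eq_iff)
    then show "q \<in> range torus_param" by blast
  qed (auto simp: std_torus_def torus_param_def)
  then have "\<Sigma> = range (l \<circ> torus_param)" by (metis l(2) image_comp)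
  then show ?thesis using that[OF cont per] by blast
qed

theorem corollary2:
  fixes \<Sigma> :: "'n::finite phase_space set"
    and p :: "plane \<Rightarrow> complex \<times> complex"
  assumes "CARD('n) \<ge> 3"
    and "smooth_isotropic_torus \<Sigma>"
    and "lattice_covering p"
  shows "\<forall>\<epsilon>>0. \<exists>\<Sigma>'. pl_isotropic_torus p \<Sigma>' \<and> hausdorff_dist \<Sigma>' \<Sigma> < \<epsilon>"
proof (intro allI impI)
  fix \<epsilon> :: real assume "\<epsilon> > 0"
  \<comment> \<open>The Hausdorff estimate below is \<open>2 * \<mu>\<close>, so a third of
    \<open>\<epsilon>\<close> leaves strict inequality.\<close>
  define \<mu> where "\<mu> = \<epsilon> / 3"
  have \<mu>: "\<mu> > 0" using \<open>\<epsilon> > 0\<close> by (simp add: \<mu>_def)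
  obtain f :: "plane \<Rightarrow> 'n phase_space"
    where f: "continuous_on UNIV f" "\<And>x (i::int) (j::int). f (x + (of_int i, of_int j)) = f x" "\<Sigma> = range f"
    using smooth_isotropic_torus_param[OF assms(2)] by blast
  obtain z :: "int \<Rightarrow> 'n phase_space" and N :: int
    where N: "N > 0" "even N" "\<And>i. z (i + N) = z i"
      and z: "\<And>i. z i \<in> range f" "\<And>i. dist (z i) (z (i + 1)) < \<mu>" "\<And>x. \<exists>i. dist (f x) (z i) < \<mu>"
    by (rule dense_closed_chain[OF f(1,2) \<mu>]) blast
  obtain V :: "int \<Rightarrow> int \<Rightarrow> 'n phase_space"
    where per: "\<And>i j. V (i + 2 * N) j = V i j" "\<And>i j. V i (j + 3) = V i j"
      and iso: "\<And>i j. symplectic_form (V (i + 1) j - V i j) (V (i + 1) (j + 1) - V (i + 1) j) = 0"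
        "\<And>i j. symplectic_form (V (i + 1) (j + 1) - V i (j + 1)) (V i (j + 1) - V i j) = 0"
      and inj: "\<And>s t s' t'. \<lbrakk>\<bar>s - s'\<bar> < 1; \<bar>t - t'\<bar> < 1; interp V (s, t) = interp V (s', t')\<rbrakk>
        \<Longrightarrow> s = s' \<and> t = t'"
      and near: "\<And>i k. dist (V (2 * i) k) (z i) < \<mu>" "\<And>i k. dist (V (2 * i + 1) k) (z (i + 1)) < \<mu>"
    by (rule isotropic_tube_around_polygon[where z = z and N = N and \<mu> = \<mu>, OF assms(1) N \<mu>]) blast
  have "pl_isotropic_torus p (range (interp V))"
    using N(1) by (intro pl_isotropic_torus_range_interp[OF assms(3) _ _ per iso inj]) simp_all
  moreover have "hausdorff_dist (range (interp V)) \<Sigma> \<le> 2 * \<mu>"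
  proof (rule hausdorff_dist_le)
    fix q assume "q \<in> range (interp V)"
    then obtain s t where q: "q = interp V (s, t)" by auto
    define I j where "I = \<lfloor>s\<rfloor>" and "j = \<lfloor>t\<rfloor>"
    define i where "i = I div 2"
    \<comment> \<open>Every corner of the square lies within \<open>\<mu>\<close> of
      \<open>z i\<close> or of \<open>z (i + 1)\<close>, and these are less than
      \<open>\<mu>\<close> apart. The ball is convex, so it contains the interpolated point as
      well.\<close>
    have 2: "V I k \<in> cball (z i) (2 * \<mu>) \<and> V (I + 1) k \<in> cball (z i) (2 * \<mu>)" for k
    proof -
      have *: "v \<in> cball (z i) (2 * \<mu>)" if "dist v (z i) < \<mu> \<or> dist v (z (i + 1)) < \<mu>" for v
        using that z(2)[of i] \<mu> dist_triangle[of "z i" v "z (i + 1)"] by (auto simp: dist_commute)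
      have "I = 2 * i \<or> I = 2 * i + 1" by (auto simp: i_def)
      then show ?thesis
      proof
        assume I: "I = 2 * i"
        show ?thesis using near(1)[of i k] near(2)[of i k] unfolding I by (intro conjI *) simp_all
      next
        assume I: "I = 2 * i + 1"
        have I': "2 * i + 1 + 1 = 2 * (i + 1)" by simp
        show ?thesis unfolding I I' using near(2)[of i k] near(1)[of "i + 1" k] by (intro conjI *) blast+
      qed
    qed
    have "q \<in> cball (z i) (2 * \<mu>)"
      unfolding q interp_def fst_conv snd_conv I_def[symmetric] j_def[symmetric]
      using 2 by (intro patch_mem_convex) (simp_all add: frac_lt_1 less_imp_le)
    then show "\<exists>y\<in>\<Sigma>. dist q y \<le> 2 * \<mu>"
      using z(1)[of i] f(3) by (intro bexI[of _ "z i"]) (simp_all add: dist_commute)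
  next
    fix q assume "q \<in> \<Sigma>"
    then obtain i where i: "dist q (z i) < \<mu>" using z(3) f(3) by blast
    \<comment> \<open>In this direction the vertices of the tube suffice, since they are values of
      the interpolant and the chain is dense up to \<open>\<mu>\<close>.\<close>
    have "dist q (V (2 * i) 0) \<le> 2 * \<mu>"
      using dist_triangle[of q "V (2 * i) 0" "z i"] i near(1)[of i 0] by (simp add: dist_commute)
    moreover have "V (2 * i) 0 \<in> range (interp V)" using interp_int[of V "2 * i" 0] by (metis rangeI)
    ultimately show "\<exists>x\<in>range (interp V). dist q x \<le> 2 * \<mu>" by blast
  qed (use f(3) in auto)
  then have "hausdorff_dist (range (interp V)) \<Sigma> < \<epsilon>" using \<mu> by (simp add: \<mu>_def)
  ultimately show "\<exists>\<Sigma>'. pl_isotropic_torus p \<Sigma>' \<and> hausdorff_dist \<Sigma>' \<Sigma> < \<epsilon>" by blast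
qed

end
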